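(* Let $G$ be a finitely generated discrete group with no nontrivial finite normal subgroups. Then $G$ is an $\mathcal{N}(G)$-Pompeiu group; that is, for every nonempty finite subset $K\subseteq G$, the only $f\in\mathcal{N}(G)$ satisfying $\sum_{x\in gKh}f(x)=0$ for all $g,h\in G$ (equivalently $\widetilde{\chi_K}\ast L_g f=0$ for all $g\in G$) is $f=0$.
   Context: $\mathcal{N}(G)$ is the group von Neumann algebra of $G$: the weak closure of $\mathbb{C}G$ (acting on $\ell^2(G)$ by left convolution) in $\mathcal{B}(\ell^2(G))$, identified with a subspace of $\ell^2(G)$ via $T\mapsto T\chi_1$, $\chi_1$ the point mass at the identity. $\chi_K$ is the characteristic function of $K$, $\tilde u(x)=u(x^{-1})$, $L_g u(x)=u(gx)$, and $(u\ast v)(g)=\sum_{x}u(gx^{-1})v(x)$. For a class $\mathcal{C}$ of functions on $G$ containing $0$, a finite $K\subseteq G$ is a $\mathcal{C}$-Pompeiu set if $f=0$ is the only $f\in\mathcal{C}$ with $\sum_{x\in gKh}f(x)=0$ for all $g,h\in G$; $G$ is a $\mathcal{C}$-Pompeiu group if every nonempty finite subset is a $\mathcal{C}$-Pompeiu set. *)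

theory Defs
  imports "HOL-Analysis.Analysis" "HOL-Algebra.Generated_Groups" "HOL-Algebra.Coset"
begin

definition finitely_generated_group :: "('a, 'b) monoid_scheme \<Rightarrow> bool" where
  "finitely_generated_group G \<longleftrightarrow>
     (\<exists>S. finite S \<and> S \<subseteq> carrier G \<and> generate G S = carrier G)"

definition no_nontrivial_finite_normal :: "('a, 'b) monoid_scheme \<Rightarrow> bool" where
  "no_nontrivial_finite_normal G \<longleftrightarrow>
     (\<forall>H. H \<lhd> G \<and> finite H \<longrightarrow> H = {\<one>\<^bsub>G\<^esub>})"

definition ell2 :: "('a, 'b) monoid_scheme \<Rightarrow> ('a \<Rightarrow> complex) set" where
  "ell2 G = {u. (\<forall>x. x \<notin> carrier G \<longrightarrow> u x = 0) \<and>
               (\<lambda>x. (cmod (u x))\<^sup>2) summable_on carrier G}"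

definition ell2_inner :: "('a, 'b) monoid_scheme \<Rightarrow> ('a \<Rightarrow> complex) \<Rightarrow> ('a \<Rightarrow> complex) \<Rightarrow> complex" where
  "ell2_inner G u v = (\<Sum>\<^sub>\<infinity>x\<in>carrier G. u x * cnj (v x))"

definition ell2_norm :: "('a, 'b) monoid_scheme \<Rightarrow> ('a \<Rightarrow> complex) \<Rightarrow> real" where
  "ell2_norm G u = sqrt (\<Sum>\<^sub>\<infinity>x\<in>carrier G. (cmod (u x))\<^sup>2)"

definition delta_one :: "('a, 'b) monoid_scheme \<Rightarrow> 'a \<Rightarrow> complex" where
  "delta_one G = (\<lambda>x. if x = \<one>\<^bsub>G\<^esub> then 1 else 0)"

definition conv :: "('a, 'b) monoid_scheme \<Rightarrow> ('a \<Rightarrow> complex) \<Rightarrow> ('a \<Rightarrow> complex) \<Rightarrow> 'a \<Rightarrow> complex" where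
  "conv G u v = (\<lambda>g. if g \<in> carrier G
       then (\<Sum>\<^sub>\<infinity>x\<in>carrier G. u (g \<otimes>\<^bsub>G\<^esub> inv\<^bsub>G\<^esub> x) * v x) else 0)"

definition group_algebra :: "('a, 'b) monoid_scheme \<Rightarrow> ('a \<Rightarrow> complex) set" where
  "group_algebra G = {a. (\<forall>x. x \<notin> carrier G \<longrightarrow> a x = 0) \<and> finite {x. a x \<noteq> 0}}"

text \<open>Bounded linear operators on ell^2(G) (only their values on ell^2(G) matter).\<close>
definition bounded_op :: "('a, 'b) monoid_scheme \<Rightarrow> (('a \<Rightarrow> complex) \<Rightarrow> ('a \<Rightarrow> complex)) \<Rightarrow> bool" where
  "bounded_op G T \<longleftrightarrow>
     (\<forall>u\<in>ell2 G. T u \<in> ell2 G) \<and>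
     (\<forall>u\<in>ell2 G. \<forall>v\<in>ell2 G. T (\<lambda>x. u x + v x) = (\<lambda>x. T u x + T v x)) \<and>
     (\<forall>u\<in>ell2 G. \<forall>c. T (\<lambda>x. c * u x) = (\<lambda>x. c * T u x)) \<and>
     (\<exists>C. \<forall>u\<in>ell2 G. ell2_norm G (T u) \<le> C * ell2_norm G u)"

text \<open>Weak-operator closure of CG (acting by left convolution) in B(ell^2(G)):
  T lies in the closure iff every basic WOT-neighbourhood of T meets CG.\<close>
definition vN_operators :: "('a, 'b) monoid_scheme \<Rightarrow> (('a \<Rightarrow> complex) \<Rightarrow> ('a \<Rightarrow> complex)) set" where
  "vN_operators G = {T. bounded_op G T \<and>
     (\<forall>F \<epsilon>. finite F \<and> F \<subseteq> ell2 G \<times> ell2 G \<and> \<epsilon> > 0 \<longrightarrow>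
        (\<exists>a\<in>group_algebra G. \<forall>(u, v)\<in>F.
           cmod (ell2_inner G (\<lambda>x. T u x - conv G a u x) v) < \<epsilon>))}"

text \<open>The group von Neumann algebra N(G), identified with a subspace of ell^2(G)
  via T \<mapsto> T delta_1.\<close>
definition vN_alg :: "('a, 'b) monoid_scheme \<Rightarrow> ('a \<Rightarrow> complex) set" where
  "vN_alg G = (\<lambda>T. T (delta_one G)) ` vN_operators G"

definition double_coset_set :: "('a, 'b) monoid_scheme \<Rightarrow> 'a \<Rightarrow> 'a set \<Rightarrow> 'a \<Rightarrow> 'a set" where
  "double_coset_set G g K h = (\<lambda>x. g \<otimes>\<^bsub>G\<^esub> x \<otimes>\<^bsub>G\<^esub> h) ` K"

definition Pompeiu_set :: "('a, 'b) monoid_scheme \<Rightarrow> ('a \<Rightarrow> complex) set \<Rightarrow> 'a set \<Rightarrow> bool" where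
  "Pompeiu_set G C K \<longleftrightarrow>
     (\<forall>f\<in>C. (\<forall>g\<in>carrier G. \<forall>h\<in>carrier G. (\<Sum>x\<in>double_coset_set G g K h. f x) = 0)
             \<longrightarrow> f = (\<lambda>_. 0))"

definition Pompeiu_group :: "('a, 'b) monoid_scheme \<Rightarrow> ('a \<Rightarrow> complex) set \<Rightarrow> bool" where
  "Pompeiu_group G C \<longleftrightarrow>
     (\<forall>K. finite K \<and> K \<noteq> {} \<and> K \<subseteq> carrier G \<longrightarrow> Pompeiu_set G C K)"

end

theory Submission
  imports Defs
begin

text \<open>
  Only \<open>f \<in> \<ell>\<^sup>2(G)\<close> matters, and \<open>f\<close> may be taken real. If a nonzero \<open>f\<close> has vanishing sums over
  all \<open>gKh\<close>, then so has a translate normalised to value \<open>1\<close> at the identity; the function \<open>p\<close> of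
  least norm with these two properties is unique, hence invariant under conjugation, and being
  square-summable it is supported on the elements with finitely many conjugates. As \<open>G\<close> has no
  nontrivial finite normal subgroup, the lemmas of Dietzmann and Schur make this FC-centre \<open>\<Delta>\<close>
  torsion-free abelian. Restricting a translate of \<open>K\<close> to \<open>\<Delta>\<close> yields a nonzero element of the group
  ring of \<open>\<Delta>\<close> that annihilates \<open>p\<close>. This is impossible: \<open>\<Delta>\<close> can be totally ordered, and the function
  \<open>h\<close> of least norm that has \<open>h(1) = 1\<close>, lives on the nonnegative cone and is orthogonal to all
  translates of \<open>p\<close> has pairwise orthogonal translates. By Parseval their closed span contains the
  point mass at \<open>1\<close>, so \<open>p(1) = 0\<close>.
\<close>

section \<open>Real square-summable functions\<close>

text \<open>Values off \<open>A\<close> are left free, so restricting to a subset or reindexing by a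
  bijection of \<open>A\<close> needs no correction; equalities of such functions are asserted on
  \<open>A\<close> only.\<close>

definition l2 :: "'a set \<Rightarrow> ('a \<Rightarrow> real) set" where
  "l2 A = {f. (\<lambda>x. (f x)\<^sup>2) summable_on A}"

definition ip :: "'a set \<Rightarrow> ('a \<Rightarrow> real) \<Rightarrow> ('a \<Rightarrow> real) \<Rightarrow> real" where
  "ip A f g = (\<Sum>\<^sub>\<infinity>x\<in>A. f x * g x)"

lemma l2_times_summable:
  assumes "f \<in> l2 A" "g \<in> l2 A"
  shows "(\<lambda>x. f x * g x) summable_on A"
proof -
  have *: "(\<lambda>x. (f x)\<^sup>2 + (g x)\<^sup>2) summable_on A"
    using assms by (auto simp: l2_def intro: summable_on_add)
  have "norm (f x * g x) \<le> (f x)\<^sup>2 + (g x)\<^sup>2" for x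
  proof -
    have "2 * (\<bar>f x\<bar> * \<bar>g x\<bar>) \<le> (f x)\<^sup>2 + (g x)\<^sup>2"
      using sum_squares_bound[of "\<bar>f x\<bar>" "\<bar>g x\<bar>"] by simp
    moreover have "0 \<le> \<bar>f x\<bar> * \<bar>g x\<bar>" by simp
    ultimately show ?thesis unfolding real_norm_def abs_mult by linarith
  qed
  then have "(\<lambda>x. norm (f x * g x)) summable_on A"
    by (intro summable_on_comparison_test[OF *]) auto
  then show ?thesis by (rule abs_summable_summable)
qed

lemma l2_scale: "f \<in> l2 A \<Longrightarrow> (\<lambda>x. c * f x) \<in> l2 A"
  by (simp add: l2_def power_mult_distrib summable_on_cmult_right)

lemma l2_add:
  assumes "f \<in> l2 A" "g \<in> l2 A"
  shows "(\<lambda>x. f x + g x) \<in> l2 A"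
proof -
  have "(\<lambda>x. ((f x)\<^sup>2 + (g x)\<^sup>2) + 2 * (f x * g x)) summable_on A"
    using assms l2_times_summable[OF assms]
    by (intro summable_on_add summable_on_cmult_right) (auto simp: l2_def)
  then show ?thesis by (simp add: l2_def power2_sum mult.assoc)
qed

lemma l2_diff:
  assumes "f \<in> l2 A" "g \<in> l2 A"
  shows "(\<lambda>x. f x - g x) \<in> l2 A"
  using l2_add[OF assms(1) l2_scale[OF assms(2), of "-1"]] by simp

lemma l2_sum:
  assumes "finite I" "\<And>i. i \<in> I \<Longrightarrow> f i \<in> l2 A"
  shows "(\<lambda>x. \<Sum>i\<in>I. f i x) \<in> l2 A"
  using assms
proof (induction I rule: finite_induct)
  case empty
  then show ?case by (simp add: l2_def)
next
  case (insert i I)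
  then show ?case using l2_add[of "f i" A "\<lambda>x. \<Sum>i\<in>I. f i x"] by simp
qed

lemma ip_commute: "ip A f g = ip A g f"
  by (simp add: ip_def mult.commute)

lemma ip_add_left:
  assumes "f \<in> l2 A" "g \<in> l2 A" "h \<in> l2 A"
  shows "ip A (\<lambda>x. f x + g x) h = ip A f h + ip A g h"
  unfolding ip_def distrib_right
  by (intro infsum_add l2_times_summable assms)

lemma ip_scale_left: "ip A (\<lambda>x. c * f x) g = c * ip A f g"
  unfolding ip_def by (simp add: mult.assoc infsum_cmult_right')

lemma ip_diff_left:
  assumes "f \<in> l2 A" "g \<in> l2 A" "h \<in> l2 A"
  shows "ip A (\<lambda>x. f x - g x) h = ip A f h - ip A g h"
  using ip_add_left[OF assms(1) l2_scale[OF assms(2), of "-1"] assms(3)] ip_scale_left[of A "-1" g h]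
  by simp

lemma ip_sum_left:
  assumes "finite I" "\<And>i. i \<in> I \<Longrightarrow> f i \<in> l2 A" "h \<in> l2 A"
  shows "ip A (\<lambda>x. \<Sum>i\<in>I. f i x) h = (\<Sum>i\<in>I. ip A (f i) h)"
  using assms
proof (induction I rule: finite_induct)
  case empty
  then show ?case by (simp add: ip_def)
next
  case (insert i I)
  then show ?case using ip_add_left[of "f i" A "\<lambda>x. \<Sum>i\<in>I. f i x" h] l2_sum[of I f A] by simp
qed

lemma ip_self_nonneg: "0 \<le> ip A f f"
  unfolding ip_def by (intro infsum_nonneg) auto

lemma ip_self_ge_sum:
  assumes "f \<in> l2 A" "finite F" "F \<subseteq> A"
  shows "(\<Sum>x\<in>F. (f x)\<^sup>2) \<le> ip A f f"
  unfolding ip_def power2_eq_square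
  by (rule finite_sum_le_infsum) (use assms l2_times_summable in auto)

lemma ip_self_ge_point: "f \<in> l2 A \<Longrightarrow> x \<in> A \<Longrightarrow> (f x)\<^sup>2 \<le> ip A f f"
  using ip_self_ge_sum[of f A "{x}"] by simp

lemma l2_if_sums_bounded:
  assumes "\<And>F. finite F \<Longrightarrow> F \<subseteq> A \<Longrightarrow> (\<Sum>x\<in>F. (f x)\<^sup>2) \<le> B"
  shows "f \<in> l2 A" "ip A f f \<le> B"
proof -
  show *: "f \<in> l2 A"
    unfolding l2_def mem_Collect_eq
    by (intro nonneg_bdd_above_summable_on bdd_aboveI[of _ B]) (use assms in auto)
  show "ip A f f \<le> B"
    unfolding ip_def
    by (intro infsum_le_finite_sums l2_times_summable *) (use assms in \<open>auto simp: power2_eq_square\<close>)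
qed

lemma ip_self_add:
  assumes "f \<in> l2 A" "g \<in> l2 A"
  shows "ip A (\<lambda>x. f x + t * g x) (\<lambda>x. f x + t * g x)
           = ip A f f + 2 * t * ip A f g + t\<^sup>2 * ip A g g"
proof -
  note tg = l2_scale[OF assms(2), of t]
  have *: "ip A h (\<lambda>x. f x + t * g x) = ip A h f + t * ip A h g" if "h \<in> l2 A" for h
    using ip_add_left[OF assms(1) tg that] ip_scale_left[of A t g h] by (simp add: ip_commute)
  show ?thesis
    using ip_add_left[OF assms(1) tg l2_add[OF assms(1) tg]]
      ip_scale_left[of A t g "\<lambda>x. f x + t * g x"] *[OF assms(1)] *[OF assms(2)]
    by (simp add: ip_commute[of A g f] power2_eq_square algebra_simps)
qed

text \<open>Serves twice: for Cauchy-Schwarz, and with \<open>a = 0\<close> to turn minimality under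
  perturbation into orthogonality.\<close>

lemma nonneg_quadratic_discriminant:
  fixes a b c :: real
  assumes "\<And>t. 0 \<le> a + 2 * t * b + t\<^sup>2 * c"
  shows "b\<^sup>2 \<le> a * c"
proof (cases "c = 0")
  case True
  have "b = 0"
  proof (rule ccontr)
    assume "b \<noteq> 0"
    \<comment> \<open>This value of \<open>t\<close> makes the linear function
      \<open>a + 2 * t * b\<close> equal to -1.\<close>
    then have "2 * (- (a + 1) / (2 * b)) * b = - (a + 1)" by simp
    then show False using assms[of "- (a + 1) / (2 * b)"] True by simp
  qed
  then show ?thesis using True by simp
next
  case False
  have "0 \<le> c"
  proof (rule ccontr)
    assume "\<not> 0 \<le> c"
    \<comment> \<open>Averaging over \<open>t\<close> and \<open>-t\<close> removes the linear term;
      the square root chosen next turns the rest into \<open>a - (\<bar>a\<bar> + 1)\<close>, which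
      is negative.\<close>
    moreover have "0 \<le> a + t\<^sup>2 * c" for t using assms[of t] assms[of "-t"] by simp
    from this[of "sqrt ((\<bar>a\<bar> + 1) / - c)"] have "0 \<le> a + (\<bar>a\<bar> + 1) / - c * c"
      using calculation by (simp add: divide_nonneg_neg)
    moreover have "(\<bar>a\<bar> + 1) / - c * c = - (\<bar>a\<bar> + 1)" using False by simp
    ultimately show False by linarith
  qed
  then have "0 < c" using False by simp
  \<comment> \<open>Evaluation at the minimiser of the quadratic.\<close>
  have "0 \<le> a - b\<^sup>2 / c" using assms[of "- b / c"] False by (simp add: field_simps power2_eq_square)
  then show ?thesis using \<open>0 < c\<close> by (simp add: field_simps)
qed

lemma ip_Cauchy_Schwarz:
  assumes "f \<in> l2 A" "g \<in> l2 A"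
  shows "(ip A f g)\<^sup>2 \<le> ip A f f * ip A g g"
  by (rule nonneg_quadratic_discriminant) (metis ip_self_add[OF assms] ip_self_nonneg)

text \<open>Phrased with the midpoint because the convex sets below are only assumed to contain
  midpoints.\<close>

lemma ip_parallelogram:
  assumes "f \<in> l2 A" "g \<in> l2 A"
  shows "ip A (\<lambda>x. f x - g x) (\<lambda>x. f x - g x)
    = 2 * ip A f f + 2 * ip A g g - 4 * ip A (\<lambda>x. (f x + g x) / 2) (\<lambda>x. (f x + g x) / 2)"
proof -
  have "ip A (\<lambda>x. (f x + g x) / 2) (\<lambda>x. (f x + g x) / 2)
      = 1/4 * ip A (\<lambda>x. f x + 1 * g x) (\<lambda>x. f x + 1 * g x)"
    unfolding ip_def infsum_cmult_right'[symmetric] by (rule infsum_cong) (simp add: field_simps)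
  then show ?thesis
    using ip_self_add[OF assms, of 1] ip_self_add[OF assms, of "-1"] by simp
qed

section \<open>Elements of least norm in closed convex sets\<close>

lemma l2_limit_pointwise:
  assumes "\<And>n. v n \<in> l2 A" "f \<in> l2 A" "x \<in> A"
    and "(\<lambda>n. ip A (\<lambda>x. v n x - f x) (\<lambda>x. v n x - f x)) \<longlonglongrightarrow> 0"
  shows "(\<lambda>n. v n x) \<longlonglongrightarrow> f x"
proof -
  have "(\<lambda>n. (v n x - f x)\<^sup>2) \<longlonglongrightarrow> 0"
    by (rule tendsto_sandwich[OF _ _ tendsto_const assms(4)])
      (use ip_self_ge_point[OF l2_diff[OF assms(1,2)] assms(3)] in auto)
  then have "(\<lambda>n. v n x - f x) \<longlonglongrightarrow> 0" by simp
  then show ?thesis by (rule LIM_zero_cancel)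
qed

lemma l2_limit_orthogonal:
  assumes "\<And>n. v n \<in> l2 A" "f \<in> l2 A" "q \<in> l2 A" "\<And>n. ip A (v n) q = 0"
    and lim: "(\<lambda>n. ip A (\<lambda>x. v n x - f x) (\<lambda>x. v n x - f x)) \<longlonglongrightarrow> 0"
  shows "ip A f q = 0"
proof -
  have "(ip A f q)\<^sup>2 \<le> ip A (\<lambda>x. v n x - f x) (\<lambda>x. v n x - f x) * ip A q q" for n
    using ip_Cauchy_Schwarz[OF l2_diff[OF assms(1,2)] assms(3), of n]
      ip_diff_left[OF assms(1,2,3), of n] assms(4)[of n] by simp
  moreover have "(\<lambda>n. ip A (\<lambda>x. v n x - f x) (\<lambda>x. v n x - f x) * ip A q q) \<longlonglongrightarrow> 0 * ip A q q"
    by (intro tendsto_intros lim)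
  ultimately have "(ip A f q)\<^sup>2 \<le> 0 * ip A q q"
    by (intro tendsto_lowerbound[where f = "\<lambda>n. ip A (\<lambda>x. v n x - f x) (\<lambda>x. v n x - f x) * ip A q q"]) auto
  then show ?thesis by simp
qed

text \<open>A minimising sequence is Cauchy by the parallelogram law. Its limit is built pointwise
  on \<open>A\<close>, and estimates on finite partial sums are carried over to obtain convergence
  in norm.\<close>

lemma l2_minimal_norm_exists:
  assumes sub: "C \<subseteq> l2 A" and ne: "C \<noteq> {}"
    and mid: "\<And>f g. f \<in> C \<Longrightarrow> g \<in> C \<Longrightarrow> (\<lambda>x. (f x + g x) / 2) \<in> C"
    and closed: "\<And>v f. (\<And>n. v n \<in> C) \<Longrightarrow> f \<in> l2 A \<Longrightarrow>
        (\<lambda>n::nat. ip A (\<lambda>x. v n x - f x) (\<lambda>x. v n x - f x)) \<longlonglongrightarrow> 0 \<Longrightarrow> f \<in> C"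
  shows "\<exists>p\<in>C. \<forall>f\<in>C. ip A p p \<le> ip A f f"
proof -
  define d where "d = (INF f\<in>C. ip A f f)"
  have bdd: "bdd_below ((\<lambda>f. ip A f f) ` C)"
    by (rule bdd_belowI[of _ 0]) (auto simp: ip_self_nonneg)
  have d_le: "d \<le> ip A f f" if "f \<in> C" for f
    unfolding d_def by (rule cINF_lower[OF bdd that])
  have "\<exists>f\<in>C. ip A f f < d + 1 / real (Suc n)" for n
    using cINF_less_iff[OF ne bdd, of "d + 1 / real (Suc n)"] by (simp add: d_def)
  then obtain v where vC: "\<And>n. v n \<in> C" and v_less: "\<And>n. ip A (v n) (v n) < d + 1 / real (Suc n)"
    by metis
  have vl2: "v n \<in> l2 A" for n using vC sub by blast
  \<comment> \<open>The midpoint has squared norm at least \<open>d\<close>, so the contributions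
    \<open>2 * d + 2 * d - 4 * d\<close> cancel in the parallelogram law.\<close>
  have dist: "ip A (\<lambda>x. v m x - v n x) (\<lambda>x. v m x - v n x) \<le> 2 / real (Suc m) + 2 / real (Suc n)" for m n
    using ip_parallelogram[OF vl2 vl2, of m n] v_less[of m] v_less[of n] d_le[OF mid[OF vC vC, of m n]]
      mult_2[of "1 / real (Suc m)"] mult_2[of "1 / real (Suc n)"]
    by (simp del: of_nat_Suc)
  have inv0: "(\<lambda>n. c / real (Suc n)) \<longlonglongrightarrow> 0" for c
    by (rule LIMSEQ_Suc[OF lim_const_over_n])
  have "convergent (\<lambda>n. v n x)" if x: "x \<in> A" for x
  proof -
    have "Cauchy (\<lambda>n. v n x)"
    proof (rule CauchyI)
      fix e :: real assume "0 < e"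
      then have "\<forall>\<^sub>F n in sequentially. 2 / real (Suc n) < e\<^sup>2 / 2"
        using order_tendstoD(2)[OF inv0] by simp
      then obtain N where N: "\<And>n. n \<ge> N \<Longrightarrow> 2 / real (Suc n) < e\<^sup>2 / 2"
        unfolding eventually_sequentially by blast
      have "norm (v m x - v n x) < e" if "m \<ge> N" "n \<ge> N" for m n
      proof -
        have "(v m x - v n x)\<^sup>2 < e\<^sup>2"
          using ip_self_ge_point[OF l2_diff[OF vl2 vl2] x, of m n] dist[of m n] N[OF that(1)] N[OF that(2)]
          by linarith
        then show ?thesis using \<open>0 < e\<close>
          by (metis power2_abs power_less_imp_less_base less_imp_le real_norm_def)
      qed
      then show "\<exists>M. \<forall>m\<ge>M. \<forall>n\<ge>M. norm (v m x - v n x) < e" by blast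
    qed
    then show ?thesis by (rule Cauchy_convergent)
  qed
  then obtain f where f: "\<And>x. x \<in> A \<Longrightarrow> (\<lambda>n. v n x) \<longlonglongrightarrow> f x"
    unfolding convergent_def by metis
  \<comment> \<open>A Fatou argument: on a finite \<open>F\<close>, let \<open>n\<close> tend to
    infinity in \<open>dist\<close> with \<open>m\<close> fixed; the resulting bound does not depend
    on \<open>F\<close>.\<close>
  have fin_dist: "(\<Sum>x\<in>F. (v m x - f x)\<^sup>2) \<le> 2 / real (Suc m)" if F: "finite F" "F \<subseteq> A" for m F
  proof (rule tendsto_le[OF _ _ _ always_eventually])
    show "(\<lambda>n. 2 / real (Suc m) + 2 / real (Suc n)) \<longlonglongrightarrow> 2 / real (Suc m)"
      using tendsto_add[OF tendsto_const inv0] by simp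
    show "(\<lambda>n. \<Sum>x\<in>F. (v m x - v n x)\<^sup>2) \<longlonglongrightarrow> (\<Sum>x\<in>F. (v m x - f x)\<^sup>2)"
      using F by (intro tendsto_intros f) auto
    show "\<forall>n. (\<Sum>x\<in>F. (v m x - v n x)\<^sup>2) \<le> 2 / real (Suc m) + 2 / real (Suc n)"
      using ip_self_ge_sum[OF l2_diff[OF vl2 vl2] F] dist order_trans by blast
  qed simp
  have vf: "ip A (\<lambda>x. v m x - f x) (\<lambda>x. v m x - f x) \<le> 2 / real (Suc m)" for m
    by (rule l2_if_sums_bounded(2)) (rule fin_dist)
  \<comment> \<open>The same passage to the limit puts \<open>f\<close> into \<open>l2 A\<close>, as
    \<open>closed\<close> demands, and bounds its squared norm by the infimum.\<close>
  have fin_d: "(\<Sum>x\<in>F. (f x)\<^sup>2) \<le> d" if F: "finite F" "F \<subseteq> A" for F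
  proof (rule tendsto_le[OF _ _ _ always_eventually])
    show "(\<lambda>n. d + 1 / real (Suc n)) \<longlonglongrightarrow> d"
      using tendsto_add[OF tendsto_const inv0] by simp
    show "(\<lambda>n. \<Sum>x\<in>F. (v n x)\<^sup>2) \<longlonglongrightarrow> (\<Sum>x\<in>F. (f x)\<^sup>2)"
      using F by (intro tendsto_intros f) auto
    show "\<forall>n. (\<Sum>x\<in>F. (v n x)\<^sup>2) \<le> d + 1 / real (Suc n)"
      using ip_self_ge_sum[OF vl2 F] v_less by (meson less_imp_le order_trans)
  qed simp
  have fl2: "f \<in> l2 A" by (rule l2_if_sums_bounded(1)) (rule fin_d)
  have fd: "ip A f f \<le> d" by (rule l2_if_sums_bounded(2)) (rule fin_d)
  have "(\<lambda>n. ip A (\<lambda>x. v n x - f x) (\<lambda>x. v n x - f x)) \<longlonglongrightarrow> 0"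
    by (rule tendsto_sandwich[OF _ _ tendsto_const inv0[of 2]]) (simp_all add: ip_self_nonneg vf del: of_nat_Suc)
  then have "f \<in> C" by (rule closed[of v f, OF vC fl2])
  then show ?thesis using order_trans[OF fd d_le] by (intro bexI[of _ f]) auto
qed

text \<open>The midpoint of two minimisers is no shorter than they are, so the parallelogram law
  leaves no room for their difference.\<close>

lemma l2_minimal_norm_unique:
  assumes sub: "C \<subseteq> l2 A"
    and mid: "\<And>f g. f \<in> C \<Longrightarrow> g \<in> C \<Longrightarrow> (\<lambda>x. (f x + g x) / 2) \<in> C"
    and p: "p \<in> C" "\<And>f. f \<in> C \<Longrightarrow> ip A p p \<le> ip A f f"
    and q: "q \<in> C" "ip A q q = ip A p p" and x: "x \<in> A"
  shows "q x = p x"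
proof -
  have l2: "p \<in> l2 A" "q \<in> l2 A" using sub p q by auto
  have "ip A (\<lambda>x. p x - q x) (\<lambda>x. p x - q x) \<le> 0"
    using ip_parallelogram[OF l2] p(2)[OF mid[OF p(1) q(1)]] q(2) by simp
  then have "(p x - q x)\<^sup>2 \<le> 0" using ip_self_ge_point[OF l2_diff[OF l2] x] by linarith
  then show ?thesis by simp
qed

lemma l2_reindex:
  assumes "bij_betw \<phi> A A"
  shows "(\<lambda>x. f (\<phi> x)) \<in> l2 A \<longleftrightarrow> f \<in> l2 A"
  unfolding l2_def using summable_on_reindex_bij_betw[OF assms, of "\<lambda>x. (f x)\<^sup>2"] by simp

lemma ip_reindex:
  assumes "bij_betw \<phi> A A"
  shows "ip A (\<lambda>x. f (\<phi> x)) (\<lambda>x. g (\<phi> x)) = ip A f g"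
  unfolding ip_def using infsum_reindex_bij_betw[OF assms, of "\<lambda>x. f x * g x"] by simp

section \<open>Finite generation by words\<close>

context group
begin

lemma inv_cancel_left:
  assumes "x \<in> carrier G" "y \<in> carrier G"
  shows "inv x \<otimes> (x \<otimes> y) = y" "x \<otimes> (inv x \<otimes> y) = y"
  using assms by (simp_all add: m_assoc[symmetric])

definition word :: "'a list \<Rightarrow> 'a" where
  "word w = foldr (\<otimes>) w \<one>"

lemma word_simps [simp]: "word [] = \<one>" "word (x # w) = x \<otimes> word w"
  by (simp_all add: word_def)

lemma word_closed [simp]: "set w \<subseteq> carrier G \<Longrightarrow> word w \<in> carrier G"
  by (induction w) auto

lemma word_append:
  "set u \<subseteq> carrier G \<Longrightarrow> set w \<subseteq> carrier G \<Longrightarrow> word (u @ w) = word u \<otimes> word w"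
  by (induction u) (auto simp: m_assoc)

lemma word_replicate: "x \<in> carrier G \<Longrightarrow> word (replicate n x) = x [^] n"
  by (induction n) (use nat_pow_comm[of x 1] in auto)

lemma conj_mult:
  assumes "g \<in> carrier G" "x \<in> carrier G" "y \<in> carrier G"
  shows "g \<otimes> (x \<otimes> y) \<otimes> inv g = (g \<otimes> x \<otimes> inv g) \<otimes> (g \<otimes> y \<otimes> inv g)"
  using assms by (simp add: m_assoc inv_cancel_left)

lemma word_conj:
  assumes "g \<in> carrier G" "set w \<subseteq> carrier G"
  shows "word (map (\<lambda>x. g \<otimes> x \<otimes> inv g) w) = g \<otimes> word w \<otimes> inv g"
  using assms(2) by (induction w) (use assms(1) conj_mult[OF assms(1)] in auto)

text \<open>An \<open>s\<close> moves to the end past \<open>u\<close> if every letter of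
  \<open>u\<close> is replaced by its conjugate under \<open>s\<close>, which again lies in
  \<open>S\<close>. The length equation records that no letter is gained or lost.\<close>

lemma word_collect_letter:
  assumes S: "S \<subseteq> carrier G" and conj: "\<And>s t. s \<in> S \<Longrightarrow> t \<in> S \<Longrightarrow> s \<otimes> t \<otimes> inv s \<in> S"
    and s: "s \<in> S" and w: "set w \<subseteq> S"
  shows "\<exists>u. set u \<subseteq> S \<and> word w = word u \<otimes> s [^] count_list w s \<and>
           length u + count_list w s = length w"
  using w
proof (induction w)
  case Nil
  then show ?case by simp
next
  case (Cons t w)
  then obtain u where u: "set u \<subseteq> S" "word w = word u \<otimes> s [^] count_list w s"
      "length u + count_list w s = length w" by auto
  have sG: "s \<in> carrier G" and tG: "t \<in> carrier G" and uG: "set u \<subseteq> carrier G"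
    using S s u Cons.prems by auto
  show ?case
  proof (cases "t = s")
    case True
    have "s \<otimes> (word u \<otimes> s [^] count_list w s)
        = s \<otimes> word u \<otimes> inv s \<otimes> (s \<otimes> s [^] count_list w s)"
      using sG uG by (simp add: m_assoc inv_cancel_left)
    also have "\<dots> = word (map (\<lambda>x. s \<otimes> x \<otimes> inv s) u) \<otimes> s [^] Suc (count_list w s)"
      using word_conj[OF sG uG] nat_pow_Suc2[OF sG, of "count_list w s"] by simp
    finally show ?thesis
      using True u conj[OF s] by (intro exI[of _ "map (\<lambda>x. s \<otimes> x \<otimes> inv s) u"]) auto
  next
    case False
    then show ?thesis
      using u Cons.prems sG tG uG by (intro exI[of _ "t # u"]) (auto simp: m_assoc)
  qed
qed

text \<open>Common core of the lemmas of Dietzmann and Schur: collecting the occurrences of a letter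
  at the end of a word shows that in a shortest word no letter \<open>s\<close> occurs \<open>m\<close> times.\<close>

lemma finite_words:
  assumes fin: "finite S" and S: "S \<subseteq> carrier G"
    and conj: "\<And>s t. s \<in> S \<Longrightarrow> t \<in> S \<Longrightarrow> s \<otimes> t \<otimes> inv s \<in> S"
    and short: "\<And>s. s \<in> S \<Longrightarrow> \<exists>m u. set u \<subseteq> S \<and> length u < m \<and> s [^] (m::nat) = word u"
  shows "finite (word ` lists S)"
proof -
  obtain m U where U: "\<And>s. s \<in> S \<Longrightarrow> set (U s) \<subseteq> S \<and> length (U s) < m s \<and> s [^] (m s :: nat) = word (U s)"
    using short by metis
  \<comment> \<open>A word in which every letter \<open>s\<close> occurs fewer than
    \<open>m s\<close> times has length at most \<open>N\<close>.\<close>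
  define N where "N = (\<Sum>s\<in>S. m s)"
  have "\<exists>w'. set w' \<subseteq> S \<and> length w' \<le> N \<and> word w' = word w" if "set w \<subseteq> S" for w
    using that
  proof (induction w rule: length_induct)
    case (1 w)
    show ?case
    proof (cases "\<exists>s\<in>S. m s \<le> count_list w s")
      case True
      then obtain s where s: "s \<in> S" "m s \<le> count_list w s" by auto
      obtain u where u: "set u \<subseteq> S" "word w = word u \<otimes> s [^] count_list w s"
        "length u + count_list w s = length w"
        using word_collect_letter[OF S conj s(1) \<open>set w \<subseteq> S\<close>] by blast
      \<comment> \<open>Here \<open>m s\<close> of the collected letters are traded for the shorter
        word \<open>U s\<close>, so the induction on length applies to the result.\<close>
      define w' where "w' = u @ replicate (count_list w s - m s) s @ U s"
      have sub: "set u \<subseteq> carrier G" "s \<in> carrier G" "set (U s) \<subseteq> carrier G"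
        using S s u U by auto
      have "word w' = word u \<otimes> (s [^] (count_list w s - m s) \<otimes> s [^] m s)"
        using sub U[OF s(1)] word_append[of "replicate (count_list w s - m s) s" "U s"]
          word_append[of u "replicate (count_list w s - m s) s @ U s"]
        unfolding w'_def by (auto simp: word_replicate set_replicate_conv_if)
      also have "\<dots> = word w" using u(2) s(2) sub by (simp add: nat_pow_mult)
      finally have "word w' = word w" .
      moreover have "set w' \<subseteq> S" "length w' < length w"
        using u U[OF s(1)] s by (auto simp: w'_def)
      ultimately show ?thesis using 1 by metis
    next
      case False
      have "length w = (\<Sum>s\<in>S. count_list w s)"
        using sum_count_set[OF 1(2) fin] by simp
      also have "\<dots> \<le> N" unfolding N_def using False by (intro sum_mono) auto
      finally show ?thesis using 1(2) by blast
    qed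
  qed
  then have "word ` lists S \<subseteq> word ` {w. set w \<subseteq> S \<and> length w \<le> N}"
    by (fastforce simp: in_lists_conv_set image_iff)
  then show ?thesis using finite_lists_length_le[OF fin] finite_subset by blast
qed

lemma finite_powers_imp_torsion:
  assumes "x \<in> carrier G" "finite M" "\<And>n::nat. x [^] n \<in> M"
  shows "\<exists>n::nat. 0 < n \<and> x [^] n = \<one>"
proof -
  have "\<not> inj (\<lambda>n::nat. x [^] n)"
    using finite_subset[of "range (\<lambda>n::nat. x [^] n)" M] assms(2,3) infinite_UNIV_nat
    by (metis finite_imageD image_subsetI)
  then obtain i j :: nat where "i < j" "x [^] i = x [^] j"
    unfolding inj_def by (metis linorder_neqE_nat)
  then have "x [^] (j - i) = \<one>" using pow_eq_div2[OF assms(1), of j i] by simp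
  then show ?thesis using \<open>i < j\<close> by (intro exI[of _ "j - i"]) simp
qed

section \<open>The FC-centre\<close>

definition conj_class :: "'a \<Rightarrow> 'a set" where
  "conj_class x = (\<lambda>g. g \<otimes> x \<otimes> inv g) ` carrier G"

definition FC :: "'a set" where
  "FC = {x \<in> carrier G. finite (conj_class x)}"

lemma conj_class_self: "x \<in> carrier G \<Longrightarrow> x \<in> conj_class x"
  unfolding conj_class_def by (rule image_eqI[of _ _ \<one>]) auto

lemma conj_class_carrier: "x \<in> carrier G \<Longrightarrow> conj_class x \<subseteq> carrier G"
  unfolding conj_class_def by auto

lemma conj_conj:
  assumes "g \<in> carrier G" "h \<in> carrier G" "x \<in> carrier G"
  shows "g \<otimes> (h \<otimes> x \<otimes> inv h) \<otimes> inv g = (g \<otimes> h) \<otimes> x \<otimes> inv (g \<otimes> h)"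
  using assms by (simp add: m_assoc inv_mult_group)

lemma conj_class_conj:
  assumes "x \<in> carrier G" "y \<in> conj_class x" "g \<in> carrier G"
  shows "g \<otimes> y \<otimes> inv g \<in> conj_class x"
proof -
  obtain h where "h \<in> carrier G" "y = h \<otimes> x \<otimes> inv h" using assms(2) unfolding conj_class_def by auto
  then show ?thesis
    unfolding conj_class_def using conj_conj[of g h x] assms by (intro image_eqI[of _ _ "g \<otimes> h"]) auto
qed

lemma conj_inv:
  assumes "g \<in> carrier G" "x \<in> carrier G"
  shows "g \<otimes> inv x \<otimes> inv g = inv (g \<otimes> x \<otimes> inv g)"
  using assms by (simp add: m_assoc inv_mult_group)

lemma conj_pow:
  assumes "g \<in> carrier G" "x \<in> carrier G"
  shows "(g \<otimes> x \<otimes> inv g) [^] (n::nat) = g \<otimes> x [^] n \<otimes> inv g"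
  by (induction n) (use assms conj_mult[OF assms(1)] in auto)

lemma FC_subgroup: "subgroup FC G"
proof (rule subgroupI)
  show "FC \<subseteq> carrier G" by (auto simp: FC_def)
  have "conj_class \<one> \<subseteq> {\<one>}" by (auto simp: conj_class_def)
  then have "\<one> \<in> FC" by (simp add: FC_def finite_subset[of _ "{\<one>}"])
  then show "FC \<noteq> {}" by auto
next
  fix x assume x: "x \<in> FC"
  then have "conj_class (inv x) = (\<lambda>y. inv y) ` conj_class x"
    by (auto simp: conj_class_def FC_def image_image conj_inv)
  then show "inv x \<in> FC" using x by (simp add: FC_def)
next
  fix x y assume xy: "x \<in> FC" "y \<in> FC"
  have "conj_class (x \<otimes> y) \<subseteq> (\<lambda>(a, b). a \<otimes> b) ` (conj_class x \<times> conj_class y)"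
    using xy by (auto simp: conj_class_def FC_def conj_mult)
  moreover have "finite \<dots>" using xy by (simp add: FC_def)
  ultimately show "x \<otimes> y \<in> FC" using xy by (auto simp: FC_def intro: finite_subset)
qed

text \<open>Dietzmann's lemma: the conjugacy class of \<open>x\<close> is finite and closed under
  conjugation, and its elements have trivial \<open>k\<close>-th power, so the words over it form a
  finite normal subgroup.\<close>

lemma FC_torsion_in_finite_normal:
  assumes x: "x \<in> FC" and k: "0 < k" "x [^] (k::nat) = \<one>"
  shows "\<exists>M. M \<lhd> G \<and> finite M \<and> x \<in> M"
proof -
  let ?S = "conj_class x" and ?M = "word ` lists (conj_class x)"
  have xG: "x \<in> carrier G" using x by (simp add: FC_def)
  note SG = conj_class_carrier[OF xG]
  have pow: "s [^] k = \<one>" if "s \<in> ?S" for s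
    using that xG k by (auto simp: conj_class_def conj_pow)
  have fin: "finite ?M"
  proof (rule finite_words[OF _ SG])
    show "finite ?S" using x by (simp add: FC_def)
    show "s \<otimes> t \<otimes> inv s \<in> ?S" if "s \<in> ?S" "t \<in> ?S" for s t
      using conj_class_conj[OF xG that(2)] that SG by auto
    \<comment> \<open>The empty word, of length \<open>0 < k\<close>, represents
      \<open>s [^] k\<close>.\<close>
    show "\<exists>m u. set u \<subseteq> ?S \<and> length u < m \<and> s [^] (m::nat) = word u" if "s \<in> ?S" for s
      using pow[OF that] k by (intro exI[of _ k] exI[of _ "[]"]) simp
  qed
  have MG: "?M \<subseteq> carrier G" using SG by (auto intro!: word_closed)
  have mult: "a \<otimes> b \<in> ?M" if ab: "a \<in> ?M" "b \<in> ?M" for a b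
  proof -
    obtain u w where uw: "u \<in> lists ?S" "a = word u" "w \<in> lists ?S" "b = word w"
      using ab by auto
    then have "a \<otimes> b = word (u @ w)" using SG by (subst word_append) auto
    then show ?thesis using uw by auto
  qed
  have one: "\<one> \<in> ?M" by (rule image_eqI[of _ _ "[]"]) auto
  have pow_in: "a [^] (n::nat) \<in> ?M" if "a \<in> ?M" for a n
    by (induction n) (use one mult that in auto)
  have "subgroup ?M G"
  proof (rule subgroupI)
    \<comment> \<open>Words have no inverse letters; since \<open>?M\<close> is finite,
      \<open>a\<close> has finite order and its inverse is one of its powers.\<close>
    fix a assume a: "a \<in> ?M"
    then have aG: "a \<in> carrier G" using MG by auto
    obtain n :: nat where n: "0 < n" "a [^] n = \<one>"
      using finite_powers_imp_torsion[OF aG fin pow_in[OF a]] by auto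
    then have "a [^] (n - 1) \<otimes> a = \<one>" by (metis Suc_diff_1 nat_pow_Suc)
    then have "inv a = a [^] (n - 1)" using aG by (simp add: inv_equality)
    then show "inv a \<in> ?M" using pow_in[OF a] by simp
  qed (use MG mult one in auto)
  moreover have "g \<otimes> a \<otimes> inv g \<in> ?M" if g: "g \<in> carrier G" and a: "a \<in> ?M" for g a
  proof -
    obtain u where u: "u \<in> lists ?S" "a = word u" using a by auto
    then have "g \<otimes> a \<otimes> inv g = word (map (\<lambda>x. g \<otimes> x \<otimes> inv g) u)"
      using word_conj[OF g, of u] SG by fastforce
    moreover have "map (\<lambda>x. g \<otimes> x \<otimes> inv g) u \<in> lists ?S"
      using u conj_class_conj[OF xG _ g] by auto
    ultimately show ?thesis by blast
  qed
  ultimately have "?M \<lhd> G" by (simp add: normal_inv_iff)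
  moreover have "x \<in> ?M"
    by (rule image_eqI[of _ _ "[x]"]) (use xG conj_class_self in auto)
  ultimately show ?thesis using fin by blast
qed

section \<open>Commutators in the FC-centre\<close>

definition commutator :: "'a \<Rightarrow> 'a \<Rightarrow> 'a" where
  "commutator a b = a \<otimes> b \<otimes> inv a \<otimes> inv b"

lemma commutator_closed [simp]:
  "a \<in> carrier G \<Longrightarrow> b \<in> carrier G \<Longrightarrow> commutator a b \<in> carrier G"
  by (simp add: commutator_def)

lemma conj_commutator:
  assumes "g \<in> carrier G" "a \<in> carrier G" "b \<in> carrier G"
  shows "g \<otimes> commutator a b \<otimes> inv g = commutator (g \<otimes> a \<otimes> inv g) (g \<otimes> b \<otimes> inv g)"
  unfolding commutator_def
  using assms by (simp add: m_assoc inv_mult_group inv_cancel_left)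

text \<open>Here \<open>z\<close> has to commute with \<open>b\<close> only: in its application it
  is central in a subgroup, not necessarily in \<open>G\<close>.\<close>

lemma commutator_central_left:
  assumes G: "a \<in> carrier G" "b \<in> carrier G" "z \<in> carrier G"
    and z: "z \<otimes> b = b \<otimes> z"
  shows "commutator (a \<otimes> z) b = commutator a b"
proof -
  have "commutator (a \<otimes> z) b = a \<otimes> (z \<otimes> b) \<otimes> inv z \<otimes> inv a \<otimes> inv b"
    using G by (simp add: commutator_def m_assoc inv_mult_group)
  also have "\<dots> = a \<otimes> b \<otimes> (z \<otimes> inv z) \<otimes> inv a \<otimes> inv b"
    using G unfolding z by (simp add: m_assoc del: r_inv)
  finally show ?thesis using G by (simp add: commutator_def)
qed

lemma inv_commutator:
  assumes "a \<in> carrier G" "b \<in> carrier G"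
  shows "inv (commutator a b) = commutator b a"
  unfolding commutator_def using assms by (simp add: m_assoc inv_mult_group)

lemma commutator_central_right:
  assumes G: "a \<in> carrier G" "b \<in> carrier G" "z \<in> carrier G"
    and z: "z \<otimes> a = a \<otimes> z"
  shows "commutator a (b \<otimes> z) = commutator a b"
  using commutator_central_left[OF G(2,1,3) z] inv_commutator[of "b \<otimes> z" a]
    inv_commutator[of b a] G by simp

text \<open>Two commutators merge into one. The factor saved here makes the product in
  \<open>commutator_power\<close> shorter than the exponent.\<close>

lemma commutator_square:
  assumes G: "a \<in> carrier G" "b \<in> carrier G"
  shows "a \<otimes> commutator a b \<otimes> inv a \<otimes> commutator a b = commutator (a \<otimes> a) b"
proof -
  have "a \<otimes> commutator a b \<otimes> inv a \<otimes> commutator a b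
    = a \<otimes> a \<otimes> b \<otimes> inv a \<otimes> (inv b \<otimes> (inv a \<otimes> a) \<otimes> b) \<otimes> inv a \<otimes> inv b"
    unfolding commutator_def using G by (simp add: m_assoc inv_cancel_left)
  also have "\<dots> = commutator (a \<otimes> a) b"
    using G by (simp add: commutator_def m_assoc inv_mult_group inv_cancel_left)
  finally show ?thesis .
qed

text \<open>If \<open>c = [a, b]\<close> and \<open>c\<^sup>k\<close> commutes with \<open>a\<close>, then
  \<open>c\<^sup>k\<^sup>+\<^sup>1 = a c\<^sup>k a\<inverse> c = (a c a\<inverse>)\<^sup>k\<^sup>-\<^sup>1 [a\<^sup>2, b]\<close> is a product of \<open>k\<close> commutators.\<close>

lemma commutator_power:
  assumes G: "a \<in> carrier G" "b \<in> carrier G" and k: "0 < k"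
    and comm: "commutator a b [^] (k::nat) \<otimes> a = a \<otimes> commutator a b [^] k"
  shows "commutator a b [^] Suc k
    = (a \<otimes> commutator a b \<otimes> inv a) [^] (k - 1) \<otimes> commutator (a \<otimes> a) b"
proof -
  let ?c = "commutator a b"
  have cG: "?c \<in> carrier G" using G by simp
  have "?c [^] k = a \<otimes> ?c [^] k \<otimes> inv a"
    using comm G cG by (metis inv_solve_right nat_pow_closed m_closed)
  also have "\<dots> = (a \<otimes> ?c \<otimes> inv a) [^] Suc (k - 1)" using conj_pow[OF G(1) cG] k by simp
  finally have "?c [^] Suc k = (a \<otimes> ?c \<otimes> inv a) [^] (k - 1) \<otimes> (a \<otimes> ?c \<otimes> inv a \<otimes> ?c)"
    using G cG by (simp add: m_assoc)
  then show ?thesis using commutator_square[OF G] by simp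
qed

text \<open>Schur's argument in the subgroup \<open>H\<close> generated by \<open>x\<close> and
  \<open>y\<close>: its centre has finite index, so it has finitely many commutators, and by
  \<open>finite_words\<close> the powers of one of them stay in a finite set.\<close>

lemma FC_commutator_torsion:
  assumes x: "x \<in> FC" and y: "y \<in> FC"
  shows "\<exists>n::nat. 0 < n \<and> commutator x y [^] n = \<one>"
proof -
  have xG: "x \<in> carrier G" and yG: "y \<in> carrier G" using x y by (auto simp: FC_def)
  define H where "H = generate G {x, y}"
  have H: "subgroup H G" unfolding H_def using generate_is_subgroup xG yG by simp
  have HG: "\<And>h. h \<in> H \<Longrightarrow> h \<in> carrier G" using subgroup.subset[OF H] by auto
  have xH: "x \<in> H" "y \<in> H" unfolding H_def by (auto intro: generate.incl)
  \<comment> \<open>\<open>\<phi> g = \<phi> h\<close> says that \<open>inv g \<otimes> h\<close>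
    centralises both generators, hence \<open>H\<close>. Finiteness of the image of \<open>H\<close>
    therefore stands in for finite index of the centre.\<close>
  define \<phi> where "\<phi> g = (g \<otimes> x \<otimes> inv g, g \<otimes> y \<otimes> inv g)" for g
  have \<phi>_fin: "finite (\<phi> ` H)"
  proof (rule finite_subset)
    show "\<phi> ` H \<subseteq> conj_class x \<times> conj_class y" using HG by (auto simp: \<phi>_def conj_class_def)
    show "finite (conj_class x \<times> conj_class y)" using x y by (simp add: FC_def)
  qed
  have comm_gen: "inv g \<otimes> h \<otimes> t = t \<otimes> (inv g \<otimes> h)"
    if "g \<in> H" "h \<in> H" "t \<in> carrier G" "g \<otimes> t \<otimes> inv g = h \<otimes> t \<otimes> inv h" for g h t
  proof -
    have "inv g \<otimes> h \<otimes> t = inv g \<otimes> (h \<otimes> t \<otimes> inv h) \<otimes> h"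
      using that HG by (simp add: m_assoc)
    also have "\<dots> = (inv g \<otimes> g) \<otimes> t \<otimes> inv g \<otimes> h"
      using that(1-3) HG unfolding that(4)[symmetric] by (simp add: m_assoc inv_cancel_left)
    also have "\<dots> = t \<otimes> (inv g \<otimes> h)" using that HG by (simp add: m_assoc)
    finally show ?thesis .
  qed
  have central: "inv g \<otimes> h \<otimes> t = t \<otimes> (inv g \<otimes> h)"
    if gh: "g \<in> H" "h \<in> H" "\<phi> g = \<phi> h" and t: "t \<in> H" for g h t
  proof -
    let ?z = "inv g \<otimes> h"
    have zG: "?z \<in> carrier G" using gh HG by simp
    show ?thesis using t unfolding H_def
    proof (induction t rule: generate.induct)
      case one
      then show ?case using zG by simp
    next
      case (incl t)
      then show ?case using comm_gen[of g h t] gh xG yG by (auto simp: \<phi>_def)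
    next
      case (inv t)
      then have tG: "t \<in> carrier G" using xG yG by auto
      have c: "?z \<otimes> t = t \<otimes> ?z" using inv comm_gen[of g h t] gh xG yG by (auto simp: \<phi>_def)
      have "inv t \<otimes> ?z = inv t \<otimes> (?z \<otimes> t) \<otimes> inv t" using zG tG by (simp add: m_assoc)
      also have "\<dots> = ?z \<otimes> inv t" unfolding c using zG tG by (simp add: m_assoc[symmetric])
      finally show ?case by simp
    next
      case (eng s t)
      then have "s \<in> carrier G" "t \<in> carrier G" using HG unfolding H_def by auto
      then show ?case using eng.IH zG by (metis m_assoc)
    qed
  qed
  have comm_eq: "commutator a b = commutator a' b'"
    if "a \<in> H" "b \<in> H" "a' \<in> H" "b' \<in> H" "\<phi> a = \<phi> a'" "\<phi> b = \<phi> b'" for a b a' b'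
  proof -
    \<comment> \<open>The two arguments change by factors central in \<open>H\<close>, which a
      commutator does not see.\<close>
    have a': "a' = a \<otimes> (inv a \<otimes> a')" and b': "b' = b \<otimes> (inv b \<otimes> b')"
      using that HG by (simp_all add: m_assoc[symmetric])
    have "commutator a' b' = commutator a b'"
      using commutator_central_left[of a b' "inv a \<otimes> a'"] central[of a a' b'] that HG a' by simp
    also have "\<dots> = commutator a b"
      using commutator_central_right[of a b "inv b \<otimes> b'"] central[of b b' a] that HG b' by simp
    finally show ?thesis by simp
  qed
  define S where "S = (\<lambda>(a, b). commutator a b) ` (H \<times> H)"
  \<comment> \<open>\<open>F\<close> meets every coset of the centre of \<open>H\<close>, so the
    commutators of its elements exhaust \<open>S\<close>.\<close>
  have "\<exists>F. finite F \<and> F \<subseteq> H \<and> \<phi> ` F = \<phi> ` H"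
    using finite_subset_image[OF \<phi>_fin subset_refl] by metis
  then obtain F where F: "finite F" "F \<subseteq> H" "\<phi> ` F = \<phi> ` H" by blast
  have "S \<subseteq> (\<lambda>(a, b). commutator a b) ` (F \<times> F)"
  proof
    fix s assume "s \<in> S"
    then obtain a b where ab: "a \<in> H" "b \<in> H" "s = commutator a b" by (auto simp: S_def)
    then obtain a' b' where a'b': "a' \<in> F" "b' \<in> F" "\<phi> a = \<phi> a'" "\<phi> b = \<phi> b'"
      using F(3) by (metis (no_types, lifting) image_iff)
    then have "s = commutator a' b'" using comm_eq[of a b a' b'] ab F(2) by auto
    then show "s \<in> (\<lambda>(a, b). commutator a b) ` (F \<times> F)" using a'b' by auto
  qed
  then have S_fin: "finite S" using F(1) finite_subset by blast
  have S_H: "S \<subseteq> H"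
    using H by (auto simp: S_def commutator_def intro!: subgroup.m_closed subgroup.m_inv_closed)
  then have SG: "S \<subseteq> carrier G" using HG by auto
  have conjH: "g \<otimes> h \<otimes> inv g \<in> H" if "g \<in> H" "h \<in> H" for g h
    using that H by (auto intro!: subgroup.m_closed subgroup.m_inv_closed)
  have conjS: "g \<otimes> s \<otimes> inv g \<in> S" if gs: "g \<in> H" "s \<in> S" for g s
  proof -
    obtain a b where ab: "a \<in> H" "b \<in> H" "s = commutator a b" using gs by (auto simp: S_def)
    then have "g \<otimes> s \<otimes> inv g = commutator (g \<otimes> a \<otimes> inv g) (g \<otimes> b \<otimes> inv g)"
      using conj_commutator gs HG by simp
    then show ?thesis using conjH[OF gs(1)] ab by (auto simp: S_def)
  qed
  have "finite (word ` lists S)"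
  proof (rule finite_words[OF S_fin SG])
    show "s \<otimes> t \<otimes> inv s \<in> S" if "s \<in> S" "t \<in> S" for s t
      using conjS that S_H by auto
    fix s assume "s \<in> S"
    then obtain a b where ab: "a \<in> H" "b \<in> H" "s = commutator a b" by (auto simp: S_def)
    have sH: "s \<in> H" and sG: "s \<in> carrier G" using \<open>s \<in> S\<close> S_H HG by auto
    have pow_H: "s [^] (n::nat) \<in> H" for n
      by (induction n) (use sH H in \<open>auto intro: subgroup.m_closed subgroup.one_closed\<close>)
    \<comment> \<open>By pigeonhole two powers of \<open>s\<close> agree under
      \<open>\<phi>\<close>, which yields a positive \<open>k\<close> with \<open>s [^] k\<close>
      central in \<open>H\<close>.\<close>
    have "\<not> inj (\<lambda>n::nat. \<phi> (s [^] n))"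
    proof
      assume "inj (\<lambda>n::nat. \<phi> (s [^] n))"
      moreover have "finite (range (\<lambda>n::nat. \<phi> (s [^] n)))"
        by (rule finite_subset[OF _ \<phi>_fin]) (use pow_H in auto)
      ultimately show False using finite_imageD infinite_UNIV_nat by blast
    qed
    then obtain i j :: nat where ij: "i < j" "\<phi> (s [^] i) = \<phi> (s [^] j)"
      unfolding inj_def by (metis linorder_neqE_nat)
    define k where "k = j - i"
    have k: "0 < k" using ij by (simp add: k_def)
    have "s [^] j = s [^] i \<otimes> s [^] k" using ij sG by (simp add: k_def nat_pow_mult)
    then have "inv (s [^] i) \<otimes> s [^] j = s [^] k" using sG by (simp add: m_assoc[symmetric])
    then have "s [^] k \<otimes> a = a \<otimes> s [^] k" using central[OF pow_H pow_H ij(2) ab(1)] by simp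
    \<comment> \<open>The right-hand side is a product of \<open>k\<close> elements of
      \<open>S\<close>, one fewer than the exponent: the strict inequality that
      \<open>finite_words\<close> asks for.\<close>
    then have "s [^] Suc k = (a \<otimes> s \<otimes> inv a) [^] (k - 1) \<otimes> commutator (a \<otimes> a) b"
      using commutator_power[of a b k] ab HG k by simp
    also have "\<dots> = word (replicate (k - 1) (a \<otimes> s \<otimes> inv a) @ [commutator (a \<otimes> a) b])"
      using ab HG sG by (subst word_append) (auto simp: word_replicate)
    finally have "s [^] Suc k = \<dots>" .
    moreover have "a \<otimes> s \<otimes> inv a \<in> S" using conjS ab \<open>s \<in> S\<close> by simp
    moreover have "commutator (a \<otimes> a) b \<in> S"
      using ab subgroup.m_closed[OF H, of a a] by (auto simp: S_def)
    ultimately show "\<exists>m u. set u \<subseteq> S \<and> length u < m \<and> s [^] (m::nat) = word u"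
      using k by (intro exI[of _ "Suc k"] exI[of _ "replicate (k - 1) (a \<otimes> s \<otimes> inv a) @ [commutator (a \<otimes> a) b]"]) auto
  qed
  moreover have "commutator x y [^] n \<in> word ` lists S" for n :: nat
  proof (rule image_eqI)
    show "commutator x y [^] n = word (replicate n (commutator x y))"
      using xG yG by (simp add: word_replicate)
    show "replicate n (commutator x y) \<in> lists S" using xH by (auto simp: S_def)
  qed
  ultimately show ?thesis using finite_powers_imp_torsion xG yG commutator_closed by metis
qed

lemma FC_torsion_free:
  assumes "no_nontrivial_finite_normal G" "x \<in> FC" "0 < k" "x [^] (k::nat) = \<one>"
  shows "x = \<one>"
  using FC_torsion_in_finite_normal[OF assms(2-4)] assms(1)
  unfolding no_nontrivial_finite_normal_def by blast

lemma FC_commute: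
  assumes nf: "no_nontrivial_finite_normal G" and x: "x \<in> FC" and y: "y \<in> FC"
  shows "x \<otimes> y = y \<otimes> x"
proof -
  have G: "x \<in> carrier G" "y \<in> carrier G" using x y by (auto simp: FC_def)
  have "commutator x y \<in> FC"
    unfolding commutator_def
    using FC_subgroup x y by (auto intro!: subgroup.m_closed subgroup.m_inv_closed)
  then have "commutator x y = \<one>"
    using FC_commutator_torsion[OF x y] FC_torsion_free[OF nf] by blast
  then have "x \<otimes> y \<otimes> inv (y \<otimes> x) = \<one>" using G by (simp add: commutator_def m_assoc inv_mult_group)
  then show ?thesis using G by (metis inv_solve_right l_one m_closed one_closed)
qed

end

section \<open>Torsion-free abelian groups\<close>

text \<open>Zorn's lemma gives a maximal subsemigroup \<open>P\<close> avoiding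
  \<open>\<one>\<close>. If it missed both \<open>x \<noteq> \<one>\<close> and
  \<open>inv x\<close>, maximality would put positive powers of both into \<open>P\<close>, and at a
  common exponent their product would be \<open>\<one>\<close>. So \<open>P\<close> is the positive
  cone of a total order.\<close>

lemma (in comm_group) torsion_free_orderable:
  assumes tf: "\<forall>x\<in>carrier G. \<forall>n::nat. 0 < n \<longrightarrow> x [^] n = \<one> \<longrightarrow> x = \<one>"
  shows "\<exists>P \<subseteq> carrier G. \<one> \<notin> P \<and> (\<forall>x\<in>P. \<forall>y\<in>P. x \<otimes> y \<in> P) \<and>
           (\<forall>x\<in>carrier G. x = \<one> \<or> x \<in> P \<or> inv x \<in> P)"
proof -
  define \<A> where "\<A> = {P. P \<subseteq> carrier G \<and> \<one> \<notin> P \<and> (\<forall>x\<in>P. \<forall>y\<in>P. x \<otimes> y \<in> P)}"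
  have "\<exists>M\<in>\<A>. \<forall>X\<in>\<A>. M \<subseteq> X \<longrightarrow> X = M"
  proof (rule subset_Zorn')
    fix \<C> assume ch: "subset.chain \<A> \<C>"
    then have sub: "\<C> \<subseteq> \<A>" and tot: "\<And>X Y. X \<in> \<C> \<Longrightarrow> Y \<in> \<C> \<Longrightarrow> X \<subseteq> Y \<or> Y \<subseteq> X"
      by (auto simp: subset.chain_def)
    have "x \<otimes> y \<in> \<Union>\<C>" if "X \<in> \<C>" "x \<in> X" "Y \<in> \<C>" "y \<in> Y" for x y X Y
      using tot[OF that(1,3)]
    proof
      assume "X \<subseteq> Y"
      then have "x \<otimes> y \<in> Y" using that sub by (auto simp: \<A>_def)
      then show ?thesis using that by blast
    next
      assume "Y \<subseteq> X"
      then have "x \<otimes> y \<in> X" using that sub by (auto simp: \<A>_def)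
      then show ?thesis using that by blast
    qed
    then show "\<Union>\<C> \<in> \<A>" using sub by (auto simp: \<A>_def)
  qed
  then obtain P where P: "P \<in> \<A>" and max: "\<And>X. X \<in> \<A> \<Longrightarrow> P \<subseteq> X \<Longrightarrow> X = P" by blast
  have PG: "P \<subseteq> carrier G" and P1: "\<one> \<notin> P" and Pm: "\<And>x y. x \<in> P \<Longrightarrow> y \<in> P \<Longrightarrow> x \<otimes> y \<in> P"
    using P by (auto simp: \<A>_def)
  have Ppow: "x [^] n \<in> P" if "x \<in> P" "0 < n" for x and n :: nat
    using that(2)
  proof (induction n)
    case (Suc n)
    then show ?case using that(1) PG Pm by (cases "n = 0") auto
  qed simp
  have ext: "\<exists>n::nat. 0 < n \<and> inv x [^] n \<in> P" if x: "x \<in> carrier G" "x \<noteq> \<one>" "x \<notin> P" for x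
  proof (rule ccontr)
    assume none: "\<not> (\<exists>n::nat. 0 < n \<and> inv x [^] n \<in> P)"
    define Q where "Q = P \<union> {p \<otimes> x [^] n |p n. p \<in> insert \<one> P \<and> 0 < (n::nat)}"
    have Q_iff: "q \<in> Q \<longleftrightarrow> (\<exists>p n. q = p \<otimes> x [^] (n::nat) \<and> p \<in> insert \<one> P \<and> (p = \<one> \<longrightarrow> 0 < n))" for q
    proof
      assume "q \<in> Q"
      then consider "q \<in> P" | p n where "q = p \<otimes> x [^] (n::nat)" "p \<in> insert \<one> P" "0 < n"
        by (auto simp: Q_def)
      then show "\<exists>p n. q = p \<otimes> x [^] (n::nat) \<and> p \<in> insert \<one> P \<and> (p = \<one> \<longrightarrow> 0 < n)"
      proof cases
        case 1
        then show ?thesis using PG P1 by (intro exI[of _ q] exI[of _ 0]) auto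
      qed blast
    next
      assume "\<exists>p n. q = p \<otimes> x [^] (n::nat) \<and> p \<in> insert \<one> P \<and> (p = \<one> \<longrightarrow> 0 < n)"
      then obtain p n where pn: "q = p \<otimes> x [^] (n::nat)" "p \<in> insert \<one> P" "p = \<one> \<longrightarrow> 0 < n" by blast
      show "q \<in> Q"
      proof (cases "n = 0")
        case True
        then show ?thesis using pn PG by (auto simp: Q_def)
      next
        case False
        then show ?thesis unfolding Q_def using pn(1,2) by blast
      qed
    qed
    have "Q \<in> \<A>"
      unfolding \<A>_def
    proof (intro CollectI conjI ballI)
      show "Q \<subseteq> carrier G" using PG x by (auto simp: Q_def)
      show "\<one> \<notin> Q"
      proof
        assume "\<one> \<in> Q"
        then obtain p n where pn: "\<one> = p \<otimes> x [^] (n::nat)" "p \<in> insert \<one> P" "0 < n"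
          using P1 by (auto simp: Q_def)
        have pG: "p \<in> carrier G" using pn PG by auto
        \<comment> \<open>So \<open>p\<close> is a positive power of \<open>inv x\<close>: if it is
          \<open>\<one>\<close>, torsion-freeness is violated, and otherwise \<open>none\<close>
          is.\<close>
        have "p = inv (x [^] n)" using pn(1) pG x by (intro inv_equality[symmetric]) auto
        then have p: "p = inv x [^] n" using x by (simp add: nat_pow_inv)
        show False
        proof (cases "p = \<one>")
          case True
          then have "\<one> = \<one> \<otimes> x [^] n" using pn(1) by metis
          then have "x [^] n = \<one>" using x by (metis l_one nat_pow_closed)
          then show False using tf x(1,2) pn(3) by blast
        next
          case False
          then show False using none p pn by blast
        qed
      qed
    next
      fix a b assume "a \<in> Q" "b \<in> Q"
      then obtain p n q m where *: "a = p \<otimes> x [^] (n::nat)" "p \<in> insert \<one> P" "p = \<one> \<longrightarrow> 0 < n"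
        "b = q \<otimes> x [^] (m::nat)" "q \<in> insert \<one> P" "q = \<one> \<longrightarrow> 0 < m" unfolding Q_iff by blast
      have G: "p \<in> carrier G" "q \<in> carrier G" using * PG by auto
      have "a \<otimes> b = (p \<otimes> q) \<otimes> (x [^] n \<otimes> x [^] m)"
        using * G x by (simp add: m_ac)
      then have "a \<otimes> b = (p \<otimes> q) \<otimes> x [^] (n + m)" using x by (simp add: nat_pow_mult)
      moreover have "p \<otimes> q \<in> insert \<one> P" using * G Pm by auto
      moreover have "p \<otimes> q = \<one> \<longrightarrow> 0 < n + m" using * G Pm P1 by auto metis+
      ultimately show "a \<otimes> b \<in> Q" unfolding Q_iff by blast
    qed
    moreover have "P \<subseteq> Q" by (auto simp: Q_def)
    ultimately have "Q = P" using max by blast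
    moreover have "x \<in> Q"
      unfolding Q_iff by (rule exI[of _ \<one>], rule exI[of _ 1]) (use x in auto)
    ultimately show False using x by simp
  qed
  have "x = \<one> \<or> x \<in> P \<or> inv x \<in> P" if x: "x \<in> carrier G" for x
  proof (rule ccontr)
    assume no: "\<not> ?thesis"
    then obtain n :: nat where n: "0 < n" "inv x [^] n \<in> P" using ext[of x] x by blast
    obtain m :: nat where m: "0 < m" "x [^] m \<in> P" using ext[of "inv x"] x no by auto
    have "x [^] (m * n) \<in> P" using Ppow[OF m(2) n(1)] x by (simp add: nat_pow_pow)
    moreover have "inv x [^] (m * n) \<in> P" using Ppow[OF n(2) m(1)] x by (simp add: nat_pow_pow mult.commute)
    ultimately have "x [^] (m * n) \<otimes> inv x [^] (m * n) \<in> P" by (rule Pm)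
    moreover have "x [^] (m * n) \<otimes> inv x [^] (m * n) = \<one>" using x by (simp add: nat_pow_inv)
    ultimately show False using P1 by simp
  qed
  then show ?thesis using PG P1 Pm by (intro exI[of _ P]) auto
qed

text \<open>Used to translate \<open>K\<close> into the nonnegative cone with \<open>\<one>\<close>
  among its points: \<open>k\<close> is the least element of \<open>K\<close> for the order with
  positive cone \<open>P\<close>.\<close>

lemma (in group) positive_cone_minimum:
  assumes PG: "P \<subseteq> carrier G" and Pm: "\<And>x y. x \<in> P \<Longrightarrow> y \<in> P \<Longrightarrow> x \<otimes> y \<in> P"
    and tot: "\<And>x. x \<in> carrier G \<Longrightarrow> x = \<one> \<or> x \<in> P \<or> inv x \<in> P"
    and K: "finite K" "K \<noteq> {}" "K \<subseteq> carrier G"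
  shows "\<exists>k\<in>K. \<forall>y\<in>K. inv k \<otimes> y \<in> insert \<one> P"
  using K
proof (induction K rule: finite_ne_induct)
  case (singleton x)
  then show ?case by simp
next
  case (insert x F)
  then obtain k where k: "k \<in> F" "\<And>y. y \<in> F \<Longrightarrow> inv k \<otimes> y \<in> insert \<one> P" by auto
  have G: "x \<in> carrier G" "k \<in> carrier G" "F \<subseteq> carrier G" using insert.prems k by auto
  show ?case
  proof (cases "inv k \<otimes> x \<in> insert \<one> P")
    case True
    then show ?thesis using k by blast
  next
    case False
    then have "inv (inv k \<otimes> x) \<in> P" using tot[of "inv k \<otimes> x"] G by auto
    then have xk: "inv x \<otimes> k \<in> P" using G by (simp add: inv_mult_group)
    have "inv x \<otimes> y \<in> insert \<one> P" if "y \<in> F" for y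
    proof -
      have "inv x \<otimes> y = (inv x \<otimes> k) \<otimes> (inv k \<otimes> y)"
        using G that by (simp add: m_assoc inv_cancel_left subset_iff)
      then show ?thesis using k(2)[OF that] xk Pm[OF xk] G by auto
    qed
    then show ?thesis using G by auto
  qed
qed

section \<open>Orthogonality between translates of square-summable functions\<close>

lemma (in group) bij_betw_left_mult: "g \<in> carrier G \<Longrightarrow> bij_betw (\<lambda>x. g \<otimes> x) (carrier G) (carrier G)"
  by (rule bij_betw_byWitness[where f' = "\<lambda>x. inv g \<otimes> x"]) (auto simp: inv_cancel_left)

text \<open>The coefficients of the point mass at \<open>\<one>\<close> along the translates of \<open>h\<close> are the values of \<open>h\<close>,
  so their square sum is \<open>\<parallel>h\<parallel>\<^sup>2\<close>: Parseval's equality holds for it.\<close>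

lemma (in group) orthogonal_translates_total:
  assumes h: "h \<in> l2 (carrier G)" and p: "p \<in> l2 (carrier G)"
    and h1: "h \<one> \<noteq> 0"
    and orth: "\<And>g. g \<in> carrier G \<Longrightarrow> g \<noteq> \<one> \<Longrightarrow> ip (carrier G) h (\<lambda>x. h (g \<otimes> x)) = 0"
    and hp: "\<And>g. g \<in> carrier G \<Longrightarrow> ip (carrier G) (\<lambda>x. h (g \<otimes> x)) p = 0"
  shows "p \<one> = 0"
proof -
  let ?A = "carrier G" and ?\<delta> = "\<lambda>x. if x = \<one> then 1 else 0 :: real"
  let ?t = "\<lambda>g x. h (g \<otimes> x)"
  define c where "c = ip ?A h h"
  have "0 < (h \<one>)\<^sup>2" using h1 by simp
  then have c: "0 < c" unfolding c_def using ip_self_ge_point[OF h one_closed] by linarith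
  have t: "?t g \<in> l2 ?A" if "g \<in> ?A" for g using l2_reindex[OF bij_betw_left_mult[OF that]] h by simp
  have ip_t: "ip ?A (?t g) (?t k) = (if g = k then c else 0)" if gk: "g \<in> ?A" "k \<in> ?A" for g k
  proof -
    have "ip ?A (?t g) (?t k) = ip ?A (\<lambda>x. h (g \<otimes> x)) (\<lambda>x. h (k \<otimes> inv g \<otimes> (g \<otimes> x)))"
      unfolding ip_def by (rule infsum_cong) (use gk in \<open>simp add: m_assoc inv_cancel_left\<close>)
    also have "\<dots> = ip ?A h (\<lambda>x. h (k \<otimes> inv g \<otimes> x))"
      by (rule ip_reindex[OF bij_betw_left_mult[OF gk(1)]])
    also have "\<dots> = (if g = k then c else 0)"
    proof (cases "g = k")
      case True
      then show ?thesis using gk unfolding c_def ip_def by (auto intro!: infsum_cong)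
    next
      case False
      then have "k \<otimes> inv g \<noteq> \<one>" using gk by (metis inv_equality inv_inv inv_closed)
      then show ?thesis using orth[of "k \<otimes> inv g"] gk False by simp
    qed
    finally show ?thesis .
  qed
  have ip_\<delta>: "ip ?A ?\<delta> f = f \<one>" for f
  proof -
    have "ip ?A ?\<delta> f = infsum (\<lambda>x. ?\<delta> x * f x) {\<one>}"
      unfolding ip_def by (rule infsum_cong_neutral) auto
    then show ?thesis by simp
  qed
  have \<delta>: "?\<delta> \<in> l2 ?A"
  proof -
    have "(\<lambda>x. (?\<delta> x)\<^sup>2) summable_on {\<one>} \<longleftrightarrow> (\<lambda>x. (?\<delta> x)\<^sup>2) summable_on ?A"
      by (rule summable_on_cong_neutral) auto
    then show ?thesis by (simp add: l2_def)
  qed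
  have bound: "(p \<one>)\<^sup>2 \<le> (1 - (\<Sum>g\<in>F. (h g)\<^sup>2) / c) * ip ?A p p" if F: "finite F" "F \<subseteq> ?A" for F
  proof -
    \<comment> \<open>\<open>s\<close> is the orthogonal projection of the point mass to the span of
      the translates from \<open>F\<close>: the point mass has inner product \<open>h g\<close> with
      \<open>?t g\<close>, whose squared norm is \<open>c\<close>. As \<open>s\<close> is orthogonal
      to \<open>p\<close>, Cauchy-Schwarz on the remainder bounds \<open>p \<one>\<close>.\<close>
    define s where "s x = (\<Sum>g\<in>F. (h g / c) * ?t g x)" for x
    have FA: "g \<in> ?A" if "g \<in> F" for g using F that by auto
    have summand: "(\<lambda>x. (h g / c) * ?t g x) \<in> l2 ?A" if "g \<in> F" for g
      using l2_scale[OF t[OF FA[OF that]]] .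
    have s: "s \<in> l2 ?A" unfolding s_def by (rule l2_sum[OF F(1)]) (rule summand)
    have s_left: "ip ?A s f = (\<Sum>g\<in>F. (h g / c) * ip ?A (?t g) f)" if "f \<in> l2 ?A" for f
    proof -
      have "ip ?A s f = (\<Sum>g\<in>F. ip ?A (\<lambda>x. (h g / c) * ?t g x) f)"
        unfolding s_def by (rule ip_sum_left[OF F(1) _ that]) (rule summand)
      then show ?thesis unfolding ip_scale_left .
    qed
    have "ip ?A (?t g) s = h g" if g: "g \<in> F" for g
    proof -
      have "ip ?A s (?t g) = (\<Sum>k\<in>F. (h k / c) * (if k = g then c else 0))"
        using s_left[OF t[OF FA[OF g]]] ip_t FA g by simp
      also have "\<dots> = (\<Sum>k\<in>F. if k = g then h k else 0)" using c by (intro sum.cong) auto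
      also have "\<dots> = h g" using F g by simp
      finally show ?thesis by (simp add: ip_commute)
    qed
    then have ss: "ip ?A s s = (\<Sum>g\<in>F. (h g)\<^sup>2) / c"
      using s_left[OF s] by (simp add: sum_divide_distrib power2_eq_square)
    have "?t g \<one> = h g" if "g \<in> F" for g using FA[OF that] by simp
    then have "s \<one> = (\<Sum>g\<in>F. (h g)\<^sup>2) / c"
      unfolding s_def sum_divide_distrib by (intro sum.cong) (auto simp: power2_eq_square)
    then have "ip ?A (\<lambda>x. ?\<delta> x + (-1) * s x) (\<lambda>x. ?\<delta> x + (-1) * s x) = 1 - (\<Sum>g\<in>F. (h g)\<^sup>2) / c"
      using ip_self_add[OF \<delta> s, of "-1"] ip_\<delta>[of s] ip_\<delta>[of ?\<delta>] ss by simp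
    then have r: "ip ?A (\<lambda>x. ?\<delta> x - s x) (\<lambda>x. ?\<delta> x - s x) = 1 - (\<Sum>g\<in>F. (h g)\<^sup>2) / c" by simp
    have "ip ?A s p = 0" using s_left[OF p] hp FA by simp
    then have "ip ?A (\<lambda>x. ?\<delta> x - s x) p = p \<one>" using ip_diff_left[OF \<delta> s p] ip_\<delta>[of p] by simp
    then show ?thesis using ip_Cauchy_Schwarz[OF l2_diff[OF \<delta> s] p] r by simp
  qed
  \<comment> \<open>As \<open>F\<close> exhausts the group, the square sums tend to \<open>c\<close>
    and the bound tends to 0.\<close>
  have "((\<lambda>x. (h x)\<^sup>2) has_sum c) ?A"
    using h unfolding c_def ip_def l2_def by (simp add: power2_eq_square)
  then have "(sum (\<lambda>x. (h x)\<^sup>2) \<longlongrightarrow> c) (finite_subsets_at_top ?A)" by (simp add: has_sum_def)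
  then have "((\<lambda>F. (1 - (\<Sum>g\<in>F. (h g)\<^sup>2) / c) * ip ?A p p) \<longlongrightarrow> (1 - c / c) * ip ?A p p)
      (finite_subsets_at_top ?A)"
    using c by (intro tendsto_intros) auto
  moreover have "\<forall>\<^sub>F F in finite_subsets_at_top ?A. (p \<one>)\<^sup>2 \<le> (1 - (\<Sum>g\<in>F. (h g)\<^sup>2) / c) * ip ?A p p"
    by (rule eventually_finite_subsets_at_top_weakI) (use bound in auto)
  ultimately have "(p \<one>)\<^sup>2 \<le> (1 - c / c) * ip ?A p p"
    by (intro tendsto_lowerbound) auto
  then show ?thesis using c by simp
qed

text \<open>A Helson--Lowdenslager argument: minimality of \<open>h\<close> makes it orthogonal to its own translates.\<close>

lemma (in comm_group) torsion_free_zero_divisor: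
  assumes tf: "\<forall>x\<in>carrier G. \<forall>n::nat. 0 < n \<longrightarrow> x [^] n = \<one> \<longrightarrow> x = \<one>"
    and K: "finite K" "K \<noteq> {}" "K \<subseteq> carrier G"
    and p: "p \<in> l2 (carrier G)"
    and zero: "\<And>g. g \<in> carrier G \<Longrightarrow> (\<Sum>y\<in>K. p (g \<otimes> y)) = 0"
  shows "p \<one> = 0"
proof -
  let ?A = "carrier G"
  obtain P where PG: "P \<subseteq> ?A" and P1: "\<one> \<notin> P" and Pm: "\<And>x y. x \<in> P \<Longrightarrow> y \<in> P \<Longrightarrow> x \<otimes> y \<in> P"
    and tot: "\<And>x. x \<in> ?A \<Longrightarrow> x = \<one> \<or> x \<in> P \<or> inv x \<in> P"
    using torsion_free_orderable[OF tf] by blast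
  obtain k where k: "k \<in> K" "\<And>y. y \<in> K \<Longrightarrow> inv k \<otimes> y \<in> insert \<one> P"
  proof -
    have "\<exists>k\<in>K. \<forall>y\<in>K. inv k \<otimes> y \<in> insert \<one> P"
      by (rule positive_cone_minimum[OF PG _ _ K]) (use Pm tot in auto)
    then show thesis using that by blast
  qed
  have kA: "k \<in> ?A" and KA: "\<And>y. y \<in> K \<Longrightarrow> y \<in> ?A" using k K by auto
  have tp: "(\<lambda>x. p (g \<otimes> x)) \<in> l2 ?A" if "g \<in> ?A" for g
    using l2_reindex[OF bij_betw_left_mult[OF that]] p by simp
  define C where "C = {h \<in> l2 ?A. (\<forall>x\<in>?A. x \<notin> insert \<one> P \<longrightarrow> h x = 0) \<and> h \<one> = 1 \<and>
    (\<forall>g\<in>?A. ip ?A h (\<lambda>x. p (g \<otimes> x)) = 0)}"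
  \<comment> \<open>The indicator of \<open>K'\<close> shows that \<open>C\<close> is nonempty: the
    choice of \<open>k\<close> puts \<open>K'\<close> into the nonnegative cone and
    \<open>\<one>\<close> into \<open>K'\<close>, and \<open>zero\<close> gives the
    orthogonality.\<close>
  define K' where "K' = (\<lambda>y. inv k \<otimes> y) ` K"
  define a :: "'a \<Rightarrow> real" where "a = indicator K'"
  have K': "finite K'" "K' \<subseteq> ?A" using K kA by (auto simp: K'_def)
  have inj: "inj_on (\<lambda>y. inv k \<otimes> y) K" by (rule inj_onI) (use kA KA in auto)
  have "a \<in> C"
    unfolding C_def
  proof (intro CollectI conjI ballI impI)
    have "(\<lambda>x. (a x)\<^sup>2) summable_on K' \<longleftrightarrow> (\<lambda>x. (a x)\<^sup>2) summable_on ?A"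
      by (rule summable_on_cong_neutral) (use K' in \<open>auto simp: a_def\<close>)
    then show "a \<in> l2 ?A" using K' by (simp add: l2_def)
    show "a x = 0" if "x \<in> ?A" "x \<notin> insert \<one> P" for x
      using that k(2) by (auto simp: a_def indicator_def K'_def)
    have "\<one> \<in> K'" unfolding K'_def using k(1) kA by (intro image_eqI[of _ _ k]) auto
    then show "a \<one> = 1" by (simp add: a_def)
    fix g assume g: "g \<in> ?A"
    have "ip ?A a (\<lambda>x. p (g \<otimes> x)) = infsum (\<lambda>x. p (g \<otimes> x)) K'"
      unfolding ip_def by (rule infsum_cong_neutral) (use K' in \<open>auto simp: a_def\<close>)
    also have "\<dots> = (\<Sum>x\<in>K'. p (g \<otimes> x))" using K' by simp
    also have "\<dots> = (\<Sum>y\<in>K. p (g \<otimes> (inv k \<otimes> y)))" unfolding K'_def by (simp add: sum.reindex[OF inj])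
    also have "\<dots> = (\<Sum>y\<in>K. p ((g \<otimes> inv k) \<otimes> y))"
      by (intro sum.cong) (use g kA KA in \<open>auto simp: m_assoc\<close>)
    also have "\<dots> = 0" using zero g kA by simp
    finally show "ip ?A a (\<lambda>x. p (g \<otimes> x)) = 0" .
  qed
  have Cl2: "C \<subseteq> l2 ?A" by (auto simp: C_def)
  have "\<exists>h\<in>C. \<forall>f\<in>C. ip ?A h h \<le> ip ?A f f"
  proof (rule l2_minimal_norm_exists[OF Cl2])
    show "C \<noteq> {}" using \<open>a \<in> C\<close> by blast
    show "(\<lambda>x. (f x + g x) / 2) \<in> C" if fg: "f \<in> C" "g \<in> C" for f g
    proof -
      have l2: "f \<in> l2 ?A" "g \<in> l2 ?A" using fg Cl2 by auto
      have eq: "(\<lambda>x. (f x + g x) / 2) = (\<lambda>x. 1/2 * (f x + g x))" by (simp add: field_simps)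
      have "ip ?A (\<lambda>x. 1/2 * (f x + g x)) (\<lambda>x. p (k \<otimes> x)) = 0" if "k \<in> ?A" for k
        unfolding ip_scale_left using ip_add_left[OF l2 tp[OF that]] fg that by (simp add: C_def)
      moreover have "(\<lambda>x. 1/2 * (f x + g x)) \<in> l2 ?A" by (intro l2_scale l2_add l2)
      ultimately show ?thesis unfolding eq using fg by (auto simp: C_def)
    qed
    fix v :: "nat \<Rightarrow> 'a \<Rightarrow> real" and f
    assume v: "\<And>n. v n \<in> C" and f: "f \<in> l2 ?A"
      and lim: "(\<lambda>n. ip ?A (\<lambda>x. v n x - f x) (\<lambda>x. v n x - f x)) \<longlonglongrightarrow> 0"
    have vl2: "v n \<in> l2 ?A" for n using v Cl2 by blast
    have pt: "(\<lambda>n. v n x) \<longlonglongrightarrow> f x" if "x \<in> ?A" for x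
      by (rule l2_limit_pointwise[OF vl2 f that lim])
    show "f \<in> C"
      unfolding C_def
    proof (intro CollectI conjI ballI impI f)
      show "f x = 0" if "x \<in> ?A" "x \<notin> insert \<one> P" for x
      proof -
        have "v n x = 0" for n using v[of n] that by (auto simp: C_def)
        then show ?thesis using pt[OF that(1)] LIMSEQ_const_iff[of 0 "f x"] by simp
      qed
      have "v n \<one> = 1" for n using v[of n] by (auto simp: C_def)
      then show "f \<one> = 1" using pt[OF one_closed] LIMSEQ_const_iff[of 1 "f \<one>"] by simp
      show "ip ?A f (\<lambda>x. p (g \<otimes> x)) = 0" if g: "g \<in> ?A" for g
        by (rule l2_limit_orthogonal[OF vl2 f tp[OF g] _ lim]) (use v g in \<open>auto simp: C_def\<close>)
    qed
  qed
  then obtain h where hC: "h \<in> C" and hmin: "\<And>f. f \<in> C \<Longrightarrow> ip ?A h h \<le> ip ?A f f" by blast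
  have h: "h \<in> l2 ?A" "h \<one> = 1" "\<And>x. x \<in> ?A \<Longrightarrow> x \<notin> insert \<one> P \<Longrightarrow> h x = 0"
    and hp: "\<And>g. g \<in> ?A \<Longrightarrow> ip ?A h (\<lambda>x. p (g \<otimes> x)) = 0" using hC by (auto simp: C_def)
  have th: "(\<lambda>x. h (g \<otimes> x)) \<in> l2 ?A" if "g \<in> ?A" for g
    using l2_reindex[OF bij_betw_left_mult[OF that]] h by simp
  have shift: "ip ?A (\<lambda>x. h (g \<otimes> x)) f = ip ?A h (\<lambda>x. f (inv g \<otimes> x))" if g: "g \<in> ?A" for g f
  proof -
    have "ip ?A (\<lambda>x. h (g \<otimes> x)) f = ip ?A (\<lambda>x. h (g \<otimes> x)) (\<lambda>x. f (inv g \<otimes> (g \<otimes> x)))"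
      unfolding ip_def by (rule infsum_cong) (use g in \<open>simp add: inv_cancel_left\<close>)
    also have "\<dots> = ip ?A h (\<lambda>x. f (inv g \<otimes> x))"
      by (rule ip_reindex[OF bij_betw_left_mult[OF g]])
    finally show ?thesis .
  qed
  have thp: "ip ?A (\<lambda>x. h (g \<otimes> x)) (\<lambda>x. p (k \<otimes> x)) = 0" if gk: "g \<in> ?A" "k \<in> ?A" for g k
  proof -
    have "ip ?A (\<lambda>x. h (g \<otimes> x)) (\<lambda>x. p (k \<otimes> x)) = ip ?A h (\<lambda>x. p (k \<otimes> (inv g \<otimes> x)))"
      by (rule shift[OF gk(1)])
    also have "\<dots> = ip ?A h (\<lambda>x. p ((k \<otimes> inv g) \<otimes> x))"
      unfolding ip_def by (rule infsum_cong) (use gk in \<open>simp add: m_assoc\<close>)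
    finally show ?thesis using hp gk by simp
  qed
  \<comment> \<open>For \<open>inv g\<close> in \<open>P\<close> the translate of \<open>h\<close>
    by \<open>g\<close> is supported in \<open>P\<close>, hence vanishes at \<open>\<one>\<close>.
    Adding any multiple of it to \<open>h\<close> stays in \<open>C\<close>, and minimality kills
    the linear term in \<open>t\<close>.\<close>
  have orth_neg: "ip ?A h (\<lambda>x. h (g \<otimes> x)) = 0" if g: "g \<in> ?A" "inv g \<in> P" for g
  proof -
    have "(\<lambda>x. h x + t * h (g \<otimes> x)) \<in> C" for t
      unfolding C_def
    proof (intro CollectI conjI ballI impI)
      show "(\<lambda>x. h x + t * h (g \<otimes> x)) \<in> l2 ?A" by (intro l2_add l2_scale h th g)
      have gP: "g \<otimes> x \<notin> insert \<one> P" if "x \<in> ?A" "x \<notin> P" for x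
      proof
        assume gx: "g \<otimes> x \<in> insert \<one> P"
        have "x = inv g \<otimes> (g \<otimes> x)" using that g by (simp add: inv_cancel_left)
        moreover have "inv g \<otimes> (g \<otimes> x) \<in> P" using gx Pm[OF g(2)] g by auto
        ultimately show False using that by simp
      qed
      show "h x + t * h (g \<otimes> x) = 0" if "x \<in> ?A" "x \<notin> insert \<one> P" for x
        using h(3)[OF that] h(3)[OF _ gP[OF that(1)]] that g by simp
      show "h \<one> + t * h (g \<otimes> \<one>) = 1"
        using h(2) h(3)[OF _ gP[OF one_closed P1]] g by simp
      show "ip ?A (\<lambda>x. h x + t * h (g \<otimes> x)) (\<lambda>x. p (k \<otimes> x)) = 0" if k: "k \<in> ?A" for k
        using ip_add_left[OF h(1) l2_scale[OF th[OF g(1)]] tp[OF k]] hp[OF k] thp[OF g(1) k]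
        by (simp add: ip_scale_left)
    qed
    from hmin[OF this] have "0 \<le> 0 + 2 * t * ip ?A h (\<lambda>x. h (g \<otimes> x))
        + t\<^sup>2 * ip ?A (\<lambda>x. h (g \<otimes> x)) (\<lambda>x. h (g \<otimes> x))" for t
      using ip_self_add[OF h(1) th[OF g(1)]] by simp
    from nonneg_quadratic_discriminant[OF this] show ?thesis by simp
  qed
  have orth: "ip ?A h (\<lambda>x. h (g \<otimes> x)) = 0" if g: "g \<in> ?A" "g \<noteq> \<one>" for g
  proof (cases "inv g \<in> P")
    case True
    then show ?thesis using orth_neg g by simp
  next
    case False
    \<comment> \<open>Moving the translation to the other factor of the inner product reduces this
      case to \<open>inv g\<close>.\<close>
    then have "inv (inv g) \<in> P" using tot[OF g(1)] g by simp
    then have "ip ?A h (\<lambda>x. h (inv g \<otimes> x)) = 0" using orth_neg[of "inv g"] g by simp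
    then show ?thesis using shift[OF g(1), of h] by (simp add: ip_commute)
  qed
  show ?thesis
  proof (rule orthogonal_translates_total[OF h(1) p])
    show "ip ?A h (\<lambda>x. h (g \<otimes> x)) = 0" if "g \<in> ?A" "g \<noteq> \<one>" for g
      by (rule orth[OF that])
    show "h \<one> \<noteq> 0" using h(2) by simp
    fix g assume g: "g \<in> ?A"
    have "ip ?A (\<lambda>x. h (g \<otimes> x)) p = ip ?A (\<lambda>x. h (g \<otimes> x)) (\<lambda>x. p (\<one> \<otimes> x))"
      unfolding ip_def by (rule infsum_cong) simp
    then show "ip ?A (\<lambda>x. h (g \<otimes> x)) p = 0" using thp[OF g one_closed] by simp
  qed
qed

section \<open>Pompeiu sets\<close>

lemma (in group) l2_Pompeiu:
  assumes nf: "no_nontrivial_finite_normal G"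
    and K: "finite K" "K \<noteq> {}" "K \<subseteq> carrier G"
    and f: "f \<in> l2 (carrier G)"
    and zero: "\<And>g h. g \<in> carrier G \<Longrightarrow> h \<in> carrier G \<Longrightarrow> (\<Sum>x\<in>K. f (g \<otimes> x \<otimes> h)) = 0"
    and x0: "x0 \<in> carrier G"
  shows "f x0 = 0"
proof (rule ccontr)
  assume fx0: "f x0 \<noteq> 0"
  let ?A = "carrier G"
  have KA: "\<And>x. x \<in> K \<Longrightarrow> x \<in> ?A" using K by auto
  define C where "C = {u \<in> l2 ?A. u \<one> = 1 \<and> (\<forall>g\<in>?A. \<forall>h\<in>?A. (\<Sum>x\<in>K. u (g \<otimes> x \<otimes> h)) = 0)}"
  have Cl2: "C \<subseteq> l2 ?A" by (auto simp: C_def)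
  have "(\<lambda>x. 1 / f x0 * f (x0 \<otimes> x)) \<in> C"
    unfolding C_def
  proof (intro CollectI conjI ballI)
    show "(\<lambda>x. 1 / f x0 * f (x0 \<otimes> x)) \<in> l2 ?A"
      using l2_scale l2_reindex[OF bij_betw_left_mult[OF x0], of f] f by blast
    show "1 / f x0 * f (x0 \<otimes> \<one>) = 1" using x0 fx0 by simp
    fix g h assume gh: "g \<in> ?A" "h \<in> ?A"
    have "(\<Sum>x\<in>K. f (x0 \<otimes> (g \<otimes> x \<otimes> h))) = (\<Sum>x\<in>K. f (x0 \<otimes> g \<otimes> x \<otimes> h))"
      by (rule sum.cong) (use gh x0 KA in \<open>auto simp: m_assoc\<close>)
    then show "(\<Sum>x\<in>K. 1 / f x0 * f (x0 \<otimes> (g \<otimes> x \<otimes> h))) = 0"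
      using zero[of "x0 \<otimes> g" h] gh x0 by (simp add: sum_divide_distrib[symmetric])
  qed
  then have ne: "C \<noteq> {}" by blast
  have mid: "(\<lambda>x. (u x + v x) / 2) \<in> C" if uv: "u \<in> C" "v \<in> C" for u v
  proof -
    have "(\<lambda>x. 1/2 * (u x + v x)) \<in> l2 ?A" using uv Cl2 by (intro l2_scale l2_add) auto
    then show ?thesis using uv by (simp add: C_def sum_divide_distrib[symmetric] sum.distrib)
  qed
  have "\<exists>p\<in>C. \<forall>u\<in>C. ip ?A p p \<le> ip ?A u u"
  proof (rule l2_minimal_norm_exists[OF Cl2 ne])
    show "(\<lambda>x. (u x + v x) / 2) \<in> C" if "u \<in> C" "v \<in> C" for u v by (rule mid[OF that])
    fix v :: "nat \<Rightarrow> 'a \<Rightarrow> real" and u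
    assume v: "\<And>n. v n \<in> C" and u: "u \<in> l2 ?A"
      and lim: "(\<lambda>n. ip ?A (\<lambda>x. v n x - u x) (\<lambda>x. v n x - u x)) \<longlonglongrightarrow> 0"
    have vl2: "v n \<in> l2 ?A" for n using v Cl2 by blast
    have pt: "(\<lambda>n. v n x) \<longlonglongrightarrow> u x" if "x \<in> ?A" for x
      by (rule l2_limit_pointwise[OF vl2 u that lim])
    show "u \<in> C"
      unfolding C_def
    proof (intro CollectI conjI ballI u)
      have "v n \<one> = 1" for n using v[of n] by (auto simp: C_def)
      then show "u \<one> = 1" using pt[OF one_closed] LIMSEQ_const_iff[of 1 "u \<one>"] by simp
      fix g h assume gh: "g \<in> ?A" "h \<in> ?A"
      have "(\<lambda>n. \<Sum>x\<in>K. v n (g \<otimes> x \<otimes> h)) \<longlonglongrightarrow> (\<Sum>x\<in>K. u (g \<otimes> x \<otimes> h))"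
        by (intro tendsto_sum pt) (use gh KA in auto)
      moreover have "(\<Sum>x\<in>K. v n (g \<otimes> x \<otimes> h)) = 0" for n using v[of n] gh by (auto simp: C_def)
      ultimately show "(\<Sum>x\<in>K. u (g \<otimes> x \<otimes> h)) = 0" by (simp add: LIMSEQ_const_iff)
    qed
  qed
  then obtain p where pC: "p \<in> C" and pmin: "\<And>u. u \<in> C \<Longrightarrow> ip ?A p p \<le> ip ?A u u" by blast
  have p: "p \<in> l2 ?A" "p \<one> = 1"
    and pzero: "\<And>g h. g \<in> ?A \<Longrightarrow> h \<in> ?A \<Longrightarrow> (\<Sum>x\<in>K. p (g \<otimes> x \<otimes> h)) = 0"
    using pC by (auto simp: C_def)
  \<comment> \<open>Conjugation preserves the norm, the value at \<open>\<one>\<close> and, because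
    the sums run over all two-sided translates of \<open>K\<close>, their vanishing. Uniqueness of
    the minimiser then makes \<open>p\<close> a class function.\<close>
  have p_conj: "p (c \<otimes> x \<otimes> inv c) = p x" if c: "c \<in> ?A" and x: "x \<in> ?A" for c x
  proof -
    have bij: "bij_betw (\<lambda>x. c \<otimes> x \<otimes> inv c) ?A ?A"
      by (rule bij_betw_byWitness[where f' = "\<lambda>x. inv c \<otimes> x \<otimes> c"])
        (use c in \<open>auto simp: m_assoc inv_cancel_left\<close>)
    have "(\<lambda>x. p (c \<otimes> x \<otimes> inv c)) \<in> C"
      unfolding C_def
    proof (intro CollectI conjI ballI)
      show "(\<lambda>x. p (c \<otimes> x \<otimes> inv c)) \<in> l2 ?A" using l2_reindex[OF bij] p by simp
      show "p (c \<otimes> \<one> \<otimes> inv c) = 1" using c p by simp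
      fix g h assume gh: "g \<in> ?A" "h \<in> ?A"
      have "(\<Sum>x\<in>K. p (c \<otimes> (g \<otimes> x \<otimes> h) \<otimes> inv c)) = (\<Sum>x\<in>K. p ((c \<otimes> g) \<otimes> x \<otimes> (h \<otimes> inv c)))"
        by (rule sum.cong) (use gh c KA in \<open>auto simp: m_assoc\<close>)
      then show "(\<Sum>x\<in>K. p (c \<otimes> (g \<otimes> x \<otimes> h) \<otimes> inv c)) = 0" using pzero gh c by simp
    qed
    then show ?thesis
      using l2_minimal_norm_unique[OF Cl2 _ pC _ _ ip_reindex[OF bij] x] mid pmin by simp
  qed
  \<comment> \<open>A nonzero value repeated on sufficiently many points of an infinite conjugacy
    class would exceed the norm of \<open>p\<close>.\<close>
  have p_FC: "p x = 0" if x: "x \<in> ?A" "x \<notin> FC" for x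
  proof (rule ccontr)
    assume px: "p x \<noteq> 0"
    then obtain n where n: "ip ?A p p < real n * (p x)\<^sup>2"
      using ex_less_of_nat_mult[of "(p x)\<^sup>2" "ip ?A p p"] by auto
    have "infinite (conj_class x)" using x by (simp add: FC_def)
    then obtain F where F: "F \<subseteq> conj_class x" "finite F" "card F = n"
      using infinite_arbitrarily_large by blast
    have "p y = p x" if "y \<in> F" for y
      using F(1) that x p_conj by (auto simp: conj_class_def)
    then have "(\<Sum>y\<in>F. (p y)\<^sup>2) = real n * (p x)\<^sup>2" using F by simp
    moreover have "F \<subseteq> ?A" using F conj_class_carrier[OF x(1)] by blast
    ultimately show False using ip_self_ge_sum[OF p(1) F(2)] n by auto
  qed
  let ?D = "G\<lparr>carrier := FC\<rparr>"
  have FCA: "\<And>x. x \<in> FC \<Longrightarrow> x \<in> ?A" by (simp add: FC_def)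
  have D: "comm_group ?D"
    using group.group_comm_groupI[OF subgroup_imp_group[OF FC_subgroup]] FC_commute[OF nf] by simp
  obtain k where k: "k \<in> K" using K by auto
  then have kA: "k \<in> ?A" by (rule KA)
  \<comment> \<open>Translating by \<open>inv k\<close> brings \<open>\<one>\<close> into the set,
    so its part inside \<open>FC\<close> is not empty.\<close>
  define K' where "K' = (\<lambda>x. inv k \<otimes> x) ` K \<inter> FC"
  have "p \<one>\<^bsub>?D\<^esub> = 0"
  proof (rule comm_group.torsion_free_zero_divisor[OF D])
    show "\<forall>x\<in>carrier ?D. \<forall>n::nat. 0 < n \<longrightarrow> x [^]\<^bsub>?D\<^esub> n = \<one>\<^bsub>?D\<^esub> \<longrightarrow> x = \<one>\<^bsub>?D\<^esub>"
      using FC_torsion_free[OF nf] by (auto simp: nat_pow_consistent[symmetric])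
    show "finite K'" "K' \<subseteq> carrier ?D" using K by (auto simp: K'_def)
    have "\<one> \<in> K'"
      unfolding K'_def using subgroup.one_closed[OF FC_subgroup] k kA
      by (auto intro!: image_eqI[of _ _ k])
    then show "K' \<noteq> {}" by auto
    show "p \<in> l2 (carrier ?D)"
      using p(1) summable_on_subset_banach[of _ ?A FC] FCA by (auto simp: l2_def)
    fix g assume "g \<in> carrier ?D"
    then have g: "g \<in> FC" "g \<in> ?A" using FCA by auto
    have inj: "inj_on (\<lambda>y. inv k \<otimes> y) K" by (rule inj_onI) (use kA KA in auto)
    \<comment> \<open>Multiplication by an element of \<open>FC\<close> preserves the complement of
      \<open>FC\<close>, where \<open>p\<close> vanishes; so the sum over \<open>K'\<close> equals
      the sum over the whole translate of \<open>K\<close>.\<close>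
    have off: "p (g \<otimes> y) = 0" if y: "y \<in> ?A" "y \<notin> FC" for y
    proof (rule p_FC)
      show "g \<otimes> y \<notin> FC"
      proof
        assume "g \<otimes> y \<in> FC"
        then have "inv g \<otimes> (g \<otimes> y) \<in> FC"
          using FC_subgroup g by (auto intro!: subgroup.m_closed subgroup.m_inv_closed)
        then show False using y g by (simp add: inv_cancel_left)
      qed
    qed (use y g in auto)
    have "(\<Sum>y\<in>K'. p (g \<otimes> y)) = (\<Sum>y\<in>(\<lambda>x. inv k \<otimes> x) ` K. p (g \<otimes> y))"
      unfolding K'_def using K kA KA by (intro sum.mono_neutral_left) (auto intro!: off)
    also have "\<dots> = (\<Sum>x\<in>K. p (g \<otimes> (inv k \<otimes> x)))" by (simp add: sum.reindex[OF inj])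
    also have "\<dots> = (\<Sum>x\<in>K. p ((g \<otimes> inv k) \<otimes> x \<otimes> \<one>))"
      by (rule sum.cong) (use g kA KA in \<open>auto simp: m_assoc\<close>)
    also have "\<dots> = 0" using pzero g kA by simp
    finally show "(\<Sum>y\<in>K'. p (g \<otimes>\<^bsub>?D\<^esub> y)) = 0" by simp
  qed
  then show False using p(2) by simp
qed

section \<open>Reduction of the complex case to the real one\<close>

lemma vN_alg_subset_ell2:
  assumes "group G"
  shows "vN_alg G \<subseteq> ell2 G"
proof -
  interpret group G by fact
  have "(\<lambda>x. (cmod (delta_one G x))\<^sup>2) summable_on {\<one>\<^bsub>G\<^esub>}
      \<longleftrightarrow> (\<lambda>x. (cmod (delta_one G x))\<^sup>2) summable_on carrier G"
    by (rule summable_on_cong_neutral) (auto simp: delta_one_def)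
  then have "delta_one G \<in> ell2 G" by (auto simp: ell2_def delta_one_def)
  then show ?thesis by (auto simp: vN_alg_def vN_operators_def bounded_op_def)
qed

lemma ell2_Re_Im:
  assumes "f \<in> ell2 G"
  shows "(\<lambda>x. Re (f x)) \<in> l2 (carrier G)" "(\<lambda>x. Im (f x)) \<in> l2 (carrier G)"
proof -
  have s: "(\<lambda>x. (cmod (f x))\<^sup>2) summable_on carrier G" using assms by (simp add: ell2_def)
  show "(\<lambda>x. Re (f x)) \<in> l2 (carrier G)" "(\<lambda>x. Im (f x)) \<in> l2 (carrier G)"
    unfolding l2_def mem_Collect_eq
    by (rule summable_on_comparison_test[OF s]; simp add: cmod_power2)+
qed

theorem theorem4p3:
  fixes G :: "('a, 'b) monoid_scheme"
  assumes "group G"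
    and "finitely_generated_group G"
    and "no_nontrivial_finite_normal G"
  shows "Pompeiu_group G (vN_alg G)"
proof -
  interpret group G by fact
  show ?thesis
    unfolding Pompeiu_group_def Pompeiu_set_def
  proof (intro allI impI ballI ext)
    fix K f x
    assume K: "finite K \<and> K \<noteq> {} \<and> K \<subseteq> carrier G" and f: "f \<in> vN_alg G"
      and zero: "\<forall>g\<in>carrier G. \<forall>h\<in>carrier G. (\<Sum>x\<in>double_coset_set G g K h. f x) = 0"
    have fl: "f \<in> ell2 G" using f vN_alg_subset_ell2[OF assms(1)] by blast
    have sum0: "(\<Sum>x\<in>K. f (g \<otimes>\<^bsub>G\<^esub> x \<otimes>\<^bsub>G\<^esub> h)) = 0" if gh: "g \<in> carrier G" "h \<in> carrier G" for g h
    proof -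
      \<comment> \<open>\<open>double_coset_set\<close> is an image, so injectivity is what makes
        its sum agree term by term with the one over \<open>K\<close>.\<close>
      have "inj_on (\<lambda>x. g \<otimes>\<^bsub>G\<^esub> x \<otimes>\<^bsub>G\<^esub> h) K"
        by (rule inj_onI) (use gh K in \<open>auto simp: subset_iff\<close>)
      then have "(\<Sum>x\<in>double_coset_set G g K h. f x) = (\<Sum>x\<in>K. f (g \<otimes>\<^bsub>G\<^esub> x \<otimes>\<^bsub>G\<^esub> h))"
        unfolding double_coset_set_def by (simp add: sum.reindex)
      then show ?thesis using zero gh by simp
    qed
    show "f x = 0"
    proof (cases "x \<in> carrier G")
      case True
      \<comment> \<open>All coefficients in the sums are 1, so the sums of the real and of the
        imaginary parts vanish separately.\<close>
      have "Re (f x) = 0"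
        by (rule l2_Pompeiu[where K = K, OF assms(3) _ _ _ ell2_Re_Im(1)[OF fl] _ True])
          (use K sum0 in \<open>simp_all flip: Re_sum\<close>)
      moreover have "Im (f x) = 0"
        by (rule l2_Pompeiu[where K = K, OF assms(3) _ _ _ ell2_Re_Im(2)[OF fl] _ True])
          (use K sum0 in \<open>simp_all flip: Im_sum\<close>)
      ultimately show ?thesis by (simp add: complex_eq_iff)
    next
      case False
      \<comment> \<open>\<open>Pompeiu_set\<close> demands zero on the whole type; off the carrier
        this is built into \<open>ell2\<close>.\<close>
      then show ?thesis using fl by (simp add: ell2_def)
    qed
  qed
qed

end
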